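(* Let $K$ be a field and $S=K[x_1,\ldots,x_n]$. If a multicomplex $\Gamma\subset\mathbb{N}_\infty^n$ is maximal shellable, then $\Gamma$ is shellable; in particular, $S/I(\Gamma)$ is a pretty clean ring.
   Context: Let $\mathbb{N}_\infty=\mathbb{N}\cup\{\infty\}$, with $\mathbb{N}_\infty^n$ ordered componentwise. For $\Gamma\subset\mathbb{N}_\infty^n$ let $\mathcal{M}(\Gamma)$ be the set of maximal elements of $\Gamma$. For $a\in\mathbb{N}_\infty^n$ the infinite part of $a$ is $\operatorname{infpt} a=\{i: a(i)=\infty\}$. A subset $\Gamma\subset\mathbb{N}_\infty^n$ is a multicomplex if (1) $a\in\Gamma$, $b\in\mathbb{N}^n_\infty$ and $b\le a$ imply $b\in\Gamma$; (2) for each $a\in\Gamma$ there is $m\in\mathcal{M}(\Gamma)$ with $a\le m$. The elements of $\mathcal{M}(\Gamma)$ are called the maximal facets of $\Gamma$. An element $a\in\Gamma$ is called a facet if $\operatorname{infpt} a=\operatorname{infpt} m$ for every $m\in\mathcal{M}(\Gamma)$ with $a\le m$. Each multicomplex has finitely many facets. For $m_1,\ldots,m_r\in\mathbb{N}_\infty^n$ let $\Gamma(m_1,\ldots,m_r)=\langle m_1,\ldots,m_r\rangle$ be the set of all $u\in\mathbb{N}_\infty^n$ with $u\le m_i$ for some $i$ (empty if $r=0$). $I(\Gamma)$ is the monomial ideal of $S$ spanned over $K$ by all monomials $x^a$, $a\in\mathbb{N}^n$, with $a\notin\Gamma$. A Stanley set is a set of the form $S=a+S^*$ with $a\in\mathbb{N}^n$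 and $S^*=\Gamma(m)$, where $m\in\mathbb{N}_\infty^n$ has $m(i)\in\{0,\infty\}$ for all $i$. A multicomplex $\Gamma$ is shellable if its facets can be ordered $a_1,\ldots,a_r$ such that (1) $S_i=\Gamma(a_i)\setminus\Gamma(a_1,\ldots,a_{i-1})$ is a Stanley set for $i=1,\ldots,r$; (2) whenever $S_i^*\subset S_j^*$, then $S_i^*=S_j^*$ or $i>j$. A multicomplex $\Gamma$ is maximal shellable if its maximal facets can be ordered $u_1,\ldots,u_r$ and there exists $s$, $1\le s\le r$, such that (1) $\operatorname{infpt} u_1=\operatorname{infpt} u_j$ for all $1\le j\le s$; (2) for $i=s+1,\ldots,r$, each maximal facet of $\langle u_1,\ldots,u_{i-1}\rangle\cap\langle u_i\rangle$ differs from $u_i$ in only one component; (3) for all $s\le j<i\le r$ such that $\operatorname{infpt} u_j\subset\operatorname{infpt} u_i$ it follows that $\operatorname{infpt} u_j=\operatorname{infpt} u_i$. For a Noetherian ring $R$ and a finitely generated $R$-module $M$, a prime filtration of $M$ is a filtration $0=M_0\subset M_1\subset\cdots\subset M_r=M$ with $M_i/M_{i-1}\cong R/P_i$, $P_i\in\operatorname{Supp}(M)$ prime. It is pretty clean if for all $i<j$ with $P_i\subset P_j$ one has $P_i=P_j$. $M$ is pretty clean if it has a pretty clean filtration; a ring is pretty clean if it is a pretty clean module over itself. *)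

theory Defs
  imports
    "HOL-Library.Extended_Nat"
    "HOL-Library.Poly_Mapping"
    "HOL-Algebra.QuotRing"
    "HOL-Algebra.Module"
    "HOL-Algebra.Algebraic_Closure_Type"
begin

hide_const (open) Multiset.mult Polynomial.smult

section \<open>Multicomplexes\<close>

text \<open>Elements of $\mathbb{N}_\infty^n$ are functions from a finite index type \<open>'n\<close> to \<^typ>\<open>enat\<close>;
  the order on functions is the componentwise one.\<close>

definition maximal_elems :: "('n \<Rightarrow> enat) set \<Rightarrow> ('n \<Rightarrow> enat) set" where
  "maximal_elems \<Gamma> = {m \<in> \<Gamma>. \<forall>a\<in>\<Gamma>. m \<le> a \<longrightarrow> a = m}"

definition infpt :: "('n \<Rightarrow> enat) \<Rightarrow> 'n set" where
  "infpt a = {i. a i = \<infinity>}"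

definition multicomplex :: "('n \<Rightarrow> enat) set \<Rightarrow> bool" where
  "multicomplex \<Gamma> \<longleftrightarrow>
     (\<forall>a\<in>\<Gamma>. \<forall>b. b \<le> a \<longrightarrow> b \<in> \<Gamma>) \<and> (\<forall>a\<in>\<Gamma>. \<exists>m\<in>maximal_elems \<Gamma>. a \<le> m)"

definition facets :: "('n \<Rightarrow> enat) set \<Rightarrow> ('n \<Rightarrow> enat) set" where
  "facets \<Gamma> = {a \<in> \<Gamma>. \<forall>m\<in>maximal_elems \<Gamma>. a \<le> m \<longrightarrow> infpt a = infpt m}"

definition generated :: "('n \<Rightarrow> enat) set \<Rightarrow> ('n \<Rightarrow> enat) set" where
  "generated A = {u. \<exists>m\<in>A. u \<le> m}"

text \<open>\<open>stanley_set S T\<close>: the set \<open>S\<close> is a Stanley set with \<open>S\<^sup>* = T\<close>. The base point has finite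
  components and is the least element of \<open>S\<close>, so \<open>S\<close> determines \<open>T\<close>.\<close>

definition stanley_set :: "('n \<Rightarrow> enat) set \<Rightarrow> ('n \<Rightarrow> enat) set \<Rightarrow> bool" where
  "stanley_set S T \<longleftrightarrow>
     (\<exists>(a :: 'n \<Rightarrow> nat) m. (\<forall>i. m i \<in> {0, \<infinity>}) \<and> T = generated {m} \<and>
        S = (\<lambda>u i. enat (a i) + u i) ` T)"

definition shellable :: "('n \<Rightarrow> enat) set \<Rightarrow> bool" where
  "shellable \<Gamma> \<longleftrightarrow>
     (\<exists>(r :: nat) a T. bij_betw a {1..r} (facets \<Gamma>) \<and>
        (\<forall>i\<in>{1..r}. stanley_set (generated {a i} - generated (a ` {1..<i})) (T i)) \<and>
        (\<forall>i\<in>{1..r}. \<forall>j\<in>{1..r}. T i \<subseteq> T j \<longrightarrow> T i = T j \<or> i > j))"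

definition maximal_shellable :: "('n \<Rightarrow> enat) set \<Rightarrow> bool" where
  "maximal_shellable \<Gamma> \<longleftrightarrow>
     (\<exists>(r :: nat) u s. bij_betw u {1..r} (maximal_elems \<Gamma>) \<and> 1 \<le> s \<and> s \<le> r \<and>
        (\<forall>j\<in>{1..s}. infpt (u 1) = infpt (u j)) \<and>
        (\<forall>i\<in>{s+1..r}. \<forall>v\<in>maximal_elems (generated (u ` {1..<i}) \<inter> generated {u i}).
           \<exists>!k. v k \<noteq> u i k) \<and>
        (\<forall>i j. s \<le> j \<and> j < i \<and> i \<le> r \<and> infpt (u j) \<subseteq> infpt (u i) \<longrightarrow>
           infpt (u j) = infpt (u i)))"


section \<open>The monomial ideal of a multicomplex\<close>

text \<open>\<open>('n \<Rightarrow>\<^sub>0 nat) \<Rightarrow>\<^sub>0 'k\<close> is the polynomial ring over \<open>'k\<close> in variables indexed by \<open>'n\<close>;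
  \<open>Poly_Mapping.single a 1\<close> is the monomial with exponent vector \<open>a\<close>, and \<open>Poly_Mapping.single 0 c\<close>
  is the constant \<open>c\<close>.\<close>

type_synonym ('n, 'k) mpoly = "('n \<Rightarrow>\<^sub>0 nat) \<Rightarrow>\<^sub>0 'k"

definition monomial_ideal :: "('n \<Rightarrow> enat) set \<Rightarrow> ('n, 'k::field) mpoly set" where
  "monomial_ideal \<Gamma> =
     Modules.module.span (\<lambda>(c::'k) p. Poly_Mapping.single 0 c * p)
       {Poly_Mapping.single a 1 | a. (\<lambda>i. enat (Poly_Mapping.lookup a i)) \<notin> \<Gamma>}"

abbreviation poly_ring :: "('n, 'k::field) mpoly ring" where
  "poly_ring \<equiv> ring_of_type_algebra"


section \<open>Pretty clean modules\<close>

definition ring_as_module :: "('a, 'z) ring_scheme \<Rightarrow> ('a, 'a) module" where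
  "ring_as_module R =
     \<lparr>carrier = carrier R, mult = (\<otimes>\<^bsub>R\<^esub>), one = \<one>\<^bsub>R\<^esub>, zero = \<zero>\<^bsub>R\<^esub>, add = (\<oplus>\<^bsub>R\<^esub>),
      smult = (\<otimes>\<^bsub>R\<^esub>)\<rparr>"

text \<open>The fields \<open>mult\<close> and \<open>one\<close> of a module record carry no meaning for modules.\<close>

definition quot_module :: "('a, 'b, 'z) module_scheme \<Rightarrow> 'b set \<Rightarrow> ('a, 'b set) module" where
  "quot_module M N =
     \<lparr>carrier = a_rcosets\<^bsub>M\<^esub> N, mult = undefined, one = undefined, zero = N, add = set_add M,
      smult = (\<lambda>r A. \<Union>x\<in>A. N +>\<^bsub>M\<^esub> (r \<odot>\<^bsub>M\<^esub> x))\<rparr>"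

definition module_isomorphic ::
    "('a, 'z) ring_scheme \<Rightarrow> ('a, 'b, 'y) module_scheme \<Rightarrow> ('a, 'c, 'x) module_scheme \<Rightarrow> bool" where
  "module_isomorphic R M N \<longleftrightarrow>
     (\<exists>f. bij_betw f (carrier M) (carrier N) \<and>
        (\<forall>x\<in>carrier M. \<forall>y\<in>carrier M. f (x \<oplus>\<^bsub>M\<^esub> y) = f x \<oplus>\<^bsub>N\<^esub> f y) \<and>
        (\<forall>r\<in>carrier R. \<forall>x\<in>carrier M. f (r \<odot>\<^bsub>M\<^esub> x) = r \<odot>\<^bsub>N\<^esub> f x))"

text \<open>The localization $M_P$ as a set of fractions: \<open>(x, s)\<close> stands for $x/s$.\<close>

definition fraction_rel ::
    "('a, 'z) ring_scheme \<Rightarrow> ('a, 'b, 'y) module_scheme \<Rightarrow> 'a set \<Rightarrow> (('b \<times> 'a) \<times> ('b \<times> 'a)) set" where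
  "fraction_rel R M P =
     {((x, s), (y, t)). x \<in> carrier M \<and> y \<in> carrier M \<and> s \<in> carrier R - P \<and> t \<in> carrier R - P \<and>
        (\<exists>w\<in>carrier R - P. w \<odot>\<^bsub>M\<^esub> (t \<odot>\<^bsub>M\<^esub> x) = w \<odot>\<^bsub>M\<^esub> (s \<odot>\<^bsub>M\<^esub> y))}"

definition localization ::
    "('a, 'z) ring_scheme \<Rightarrow> ('a, 'b, 'y) module_scheme \<Rightarrow> 'a set \<Rightarrow> ('b \<times> 'a) set set" where
  "localization R M P = (carrier M \<times> (carrier R - P)) // fraction_rel R M P"

definition Supp :: "('a, 'z) ring_scheme \<Rightarrow> ('a, 'b, 'y) module_scheme \<Rightarrow> 'a set set" where
  "Supp R M =
     {P. primeideal P R \<and> localization R M P \<noteq> {fraction_rel R M P `` {(\<zero>\<^bsub>M\<^esub>, \<one>\<^bsub>R\<^esub>)}}}"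

definition prime_filtration ::
    "('a, 'z) ring_scheme \<Rightarrow> ('a, 'b, 'y) module_scheme \<Rightarrow> nat \<Rightarrow> (nat \<Rightarrow> 'b set) \<Rightarrow>
       (nat \<Rightarrow> 'a set) \<Rightarrow> bool" where
  "prime_filtration R M r F P \<longleftrightarrow>
     F 0 = {\<zero>\<^bsub>M\<^esub>} \<and> F r = carrier M \<and> (\<forall>i\<le>r. submodule (F i) R M) \<and>
     (\<forall>i\<in>{1..r}. F (i - 1) \<subset> F i \<and> P i \<in> Supp R M \<and>
        module_isomorphic R (quot_module (M\<lparr>carrier := F i\<rparr>) (F (i - 1)))
          (quot_module (ring_as_module R) (P i)))"

text \<open>The usual standing assumptions that \<open>R\<close> is Noetherian and \<open>M\<close> finitely generated are not part
  of the definition; they hold automatically for a quotient of a polynomial ring over a field,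
  seen as a module over itself.\<close>

definition pretty_clean :: "('a, 'z) ring_scheme \<Rightarrow> ('a, 'b, 'y) module_scheme \<Rightarrow> bool" where
  "pretty_clean R M \<longleftrightarrow> Module.module R M \<and>
     (\<exists>r F P. prime_filtration R M r F P \<and>
        (\<forall>i\<in>{1..r}. \<forall>j\<in>{1..r}. i < j \<and> P i \<subseteq> P j \<longrightarrow> P i = P j))"

definition pretty_clean_ring :: "('a, 'z) ring_scheme \<Rightarrow> bool" where
  "pretty_clean_ring R \<longleftrightarrow> pretty_clean R (ring_as_module R)"

end

theory Submission
  imports Defs
begin

text \<open>The maximal shelling \<open>u\<^sub>1, \<dots>, u\<^sub>r\<close> sorts the facets into blocks: a facet belongs to the block of the
first \<open>u\<^sub>j\<close> above it, except that \<open>u\<^sub>1, \<dots>, u\<^sub>s\<close> together make up a single block. All facets in a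
block have the infinite part of the maximal facet that gives the block. List the facets block by
block, and inside a block by the sum of the finite coordinates.

For \<open>j > s\<close>, each maximal facet of \<open>\<langle>u\<^sub>1, \<dots>, u\<^sub>j\<^sub>-\<^sub>1\<rangle> \<inter> \<langle>u\<^sub>j\<rangle>\<close> lowers a single coordinate of \<open>u\<^sub>j\<close>,
and therefore a vector \<open>w \<le> u\<^sub>j\<close> avoids the earlier blocks iff \<open>d \<le> w\<close> for a fixed finite vector \<open>d\<close>
(\<open>complement_below_is_box\<close>); for the initial block take \<open>d = 0\<close>. A facet \<open>a\<close> of the block
contributes the vectors \<open>w \<le> a\<close> with \<open>d \<le> w\<close> that agree with \<open>a\<close> at its finite coordinates: if \<open>w\<close>
is smaller than \<open>a\<close> at a finite coordinate, decreasing that coordinate of \<open>a\<close> by one yields an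
earlier facet of the same block above \<open>w\<close> (\<open>new_part_of_facet\<close>). What is contributed is a Stanley
set with directions the infinite part of \<open>a\<close>, and the condition on the infinite parts of the \<open>u\<^sub>j\<close>
gives the order that a shelling requires of these directions.

A shelling \<open>a\<^sub>1, \<dots>, a\<^sub>q\<close> in turn gives a chain of monomial ideals \<open>I\<^sub>i = I(\<langle>a\<^sub>1, \<dots>, a\<^sub>i\<rangle>)\<close> that
descends from \<open>S\<close> to \<open>I(\<Gamma>)\<close>. The monomials that are in \<open>I\<^sub>i\<^sub>-\<^sub>1\<close> but not in \<open>I\<^sub>i\<close> are those with
exponent in the Stanley set of \<open>a\<^sub>i\<close>. So \<open>I\<^sub>i\<^sub>-\<^sub>1/I\<^sub>i\<close> is cyclic, generated by the monomial of the
base point, and its annihilator is the ideal generated by the variables outside the infinite part of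
\<open>a\<^sub>i\<close> (\<open>stanley_step\<close>), which is prime (\<open>primeideal_monomial_ideal\<close>). Modulo \<open>I(\<Gamma>)\<close> the chain is a
prime filtration of the quotient ring, and the order on the Stanley sets makes it pretty clean
(\<open>shellable_imp_pretty_clean\<close>).\<close>

section \<open>Finitely generated multicomplexes\<close>

lemma generated_mono_le: "v \<in> generated A \<Longrightarrow> w \<le> v \<Longrightarrow> w \<in> generated A"
  unfolding generated_def using order_trans by blast

lemma generated_mono: "A \<subseteq> B \<Longrightarrow> generated A \<subseteq> generated B"
  unfolding generated_def by blast

lemma finitely_generated_has_maximal:
  assumes "finite A" "w \<in> generated A"
  shows "\<exists>v\<in>maximal_elems (generated A). w \<le> v"
proof -
  from assms obtain m where m: "m \<in> A" "w \<le> m" unfolding generated_def by blast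
  with finite_has_maximal2[OF \<open>finite A\<close> m(1)] obtain v
    where v: "v \<in> A" "m \<le> v" "\<forall>b\<in>A. v \<le> b \<longrightarrow> v = b" by blast
  have "v \<in> maximal_elems (generated A)"
    unfolding maximal_elems_def generated_def using v by (auto intro: order_trans antisym)
  with v(2) m(2) show ?thesis by (meson order_trans)
qed

lemma generated_inter_principal:
  "generated A \<inter> generated {x} = generated ((\<lambda>m. inf m x) ` A)"
  unfolding generated_def by auto

text \<open>Two maximal elements of \<open>\<langle>A\<rangle> \<inter> \<langle>x\<rangle>\<close> that lower the same coordinate of \<open>x\<close> are comparable, hence
equal. So every coordinate \<open>k\<close> carries at most one ceiling \<open>v k < x k\<close>, and a vector \<open>w \<le> x\<close> avoids
\<open>\<langle>A\<rangle>\<close> exactly when it exceeds all the ceilings. Each ceiling is finite, being smaller than \<open>x k\<close>, so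
the bound \<open>d\<close> is a vector of natural numbers.\<close>
lemma complement_below_is_box:
  fixes x :: "'n \<Rightarrow> enat"
  assumes fin: "finite A"
    and one: "\<forall>v\<in>maximal_elems (generated A \<inter> generated {x}). \<exists>!k. v k \<noteq> x k"
  shows "\<exists>d :: 'n \<Rightarrow> nat. \<forall>w\<le>x. w \<notin> generated A \<longleftrightarrow> (\<forall>k. enat (d k) \<le> w k)"
proof -
  let ?G = "generated A \<inter> generated {x}"
  let ?M = "maximal_elems ?G"
  have above: "\<exists>v\<in>?M. w \<le> v" if "w \<in> ?G" for w
    using finitely_generated_has_maximal[of "(\<lambda>m. inf m x) ` A" w] fin that
    unfolding generated_inter_principal by simp
  have le_x: "v \<le> x" if "v \<in> ?M" for v
    using that unfolding maximal_elems_def generated_def by auto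
  have other: "v j = x j" if "v \<in> ?M" "v k \<noteq> x k" "j \<noteq> k" for v j k
    using one that by blast
  have uniq: "v = v'" if v: "v \<in> ?M" "v k \<noteq> x k" and v': "v' \<in> ?M" "v' k \<noteq> x k" for v v' k
  proof -
    have eq: "v j = v' j" if "j \<noteq> k" for j using other[OF v that] other[OF v' that] by simp
    have "v \<le> v' \<or> v' \<le> v"
    proof (cases "v k \<le> v' k")
      case True
      then have "v j \<le> v' j" for j by (cases "j = k") (use eq in auto)
      then show ?thesis by (simp add: le_fun_def)
    next
      case False
      then have "v' j \<le> v j" for j by (cases "j = k") (use eq in auto)
      then show ?thesis by (simp add: le_fun_def)
    qed
    then show ?thesis using v(1) v'(1) unfolding maximal_elems_def by blast
  qed
  \<comment> \<open>The ceiling plus one; coordinates without a ceiling are not constrained from below.\<close>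
  define d where "d k = (if \<exists>v\<in>?M. v k \<noteq> x k
      then Suc (the_enat ((THE v. v \<in> ?M \<and> v k \<noteq> x k) k)) else 0)" for k
  have d: "\<exists>n. v k = enat n \<and> d k = Suc n" if v: "v \<in> ?M" "v k \<noteq> x k" for v k
  proof -
    have the: "(THE v. v \<in> ?M \<and> v k \<noteq> x k) = v" using v uniq by blast
    have "v k \<le> x k" using le_x[OF v(1)] by (simp add: le_fun_def)
    with v(2) obtain n where n: "v k = enat n" by (cases "v k") auto
    have "\<exists>v\<in>?M. v k \<noteq> x k" using v by blast
    then have "d k = Suc (the_enat (v k))" unfolding d_def the by simp
    then show ?thesis using n by simp
  qed
  show ?thesis
  proof (intro exI[of _ d] allI impI iffI)
    fix w k assume w: "w \<le> x" "w \<notin> generated A"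
    show "enat (d k) \<le> w k"
    proof (cases "\<exists>v\<in>?M. v k \<noteq> x k")
      case True
      then obtain v where v: "v \<in> ?M" "v k \<noteq> x k" by blast
      then obtain n where n: "v k = enat n" "d k = Suc n" using d by blast
      have vA: "v \<in> generated A" using v unfolding maximal_elems_def by auto
      have "\<not> w k \<le> v k"
      proof
        assume "w k \<le> v k"
        then have "w j \<le> v j" for j
          using other[OF v, of j] w(1) by (cases "j = k") (auto simp: le_fun_def)
        then have "w \<le> v" by (simp add: le_fun_def)
        with generated_mono_le[OF vA this] w(2) show False by simp
      qed
      with n show ?thesis by (simp add: Suc_ile_eq)
    qed (simp add: d_def flip: zero_enat_def)
  next
    fix w assume w: "w \<le> x" "\<forall>k. enat (d k) \<le> w k"
    show "w \<notin> generated A"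
    proof
      assume "w \<in> generated A"
      then have "w \<in> ?G" using w(1) by (auto simp: generated_def)
      from above[OF this] obtain v where v: "v \<in> ?M" "w \<le> v" by blast
      then obtain k where k: "v k \<noteq> x k" using one by blast
      with d[OF v(1)] obtain n where "v k = enat n" "d k = Suc n" by blast
      with w(2) v(2) show False
        by (metis enat_ord_simps(1) le_fun_def not_less_eq_eq order_refl order_trans)
    qed
  qed
qed

lemma mem_infpt_iff: "k \<in> infpt a \<longleftrightarrow> a k = \<infinity>"
  by (simp add: infpt_def)

lemma infpt_mono: "a \<le> b \<Longrightarrow> infpt a \<subseteq> infpt b"
  unfolding infpt_def le_fun_def by (metis (mono_tags, lifting) Collect_mono enat_ord_simps(5))

lemma finite_below_same_infpt:
  fixes m :: "'n::finite \<Rightarrow> enat"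
  shows "finite {a. a \<le> m \<and> infpt a = infpt m}"
proof -
  let ?A = "\<lambda>k. if m k = \<infinity> then {\<infinity>} else {..m k}"
  have "finite (?A k)" for k
    by (cases "m k") (auto intro!: finite_enat_bounded)
  then have "finite (PiE UNIV ?A)" by (intro finite_PiE) auto
  moreover have "{a. a \<le> m \<and> infpt a = infpt m} \<subseteq> PiE UNIV ?A"
    by (auto simp: le_fun_def infpt_def PiE_def)
  ultimately show ?thesis by (rule finite_subset[rotated])
qed

lemma finite_enumeration_by_key:
  fixes f :: "'a \<Rightarrow> nat"
  assumes "finite A"
  shows "\<exists>(r :: nat) a. bij_betw a {1..r} A \<and>
    (\<forall>i\<in>{1..r}. \<forall>j\<in>{1..r}. i < j \<longrightarrow> f (a i) \<le> f (a j))"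
proof -
  obtain xs where xs: "set xs = A" "distinct xs" using finite_distinct_list[OF assms] by blast
  define ys where "ys = sort_key f xs"
  have ys: "set ys = A" "distinct ys" "sorted (map f ys)" using xs by (auto simp: ys_def)
  have "bij_betw (\<lambda>i. ys ! (i - 1)) {1..length ys} A"
  proof (rule bij_betw_imageI)
    show "inj_on (\<lambda>i. ys ! (i - 1)) {1..length ys}"
      using ys(2) by (auto simp: inj_on_def nth_eq_iff_index_eq)
    have "(\<lambda>i. ys ! (i - 1)) ` {1..length ys} = (!) ys ` ((\<lambda>i. i - 1) ` {1..length ys})"
      by (simp add: image_image)
    also have "(\<lambda>i. i - 1) ` {1..length ys} = {..<length ys}"
      by (auto simp: image_iff intro!: bexI[of _ "Suc _"])
    also have "(!) ys ` {..<length ys} = A" using ys(1) by (auto simp: set_conv_nth)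
    finally show "(\<lambda>i. ys ! (i - 1)) ` {1..length ys} = A" .
  qed
  moreover have "f (ys ! (i - 1)) \<le> f (ys ! (j - 1))"
    if "i \<in> {1..length ys}" "j \<in> {1..length ys}" "i < j" for i j
    using sorted_nth_mono[OF ys(3), of "i - 1" "j - 1"] that by auto
  ultimately show ?thesis by blast
qed

definition finite_degree :: "('n::finite \<Rightarrow> enat) \<Rightarrow> nat" where
  "finite_degree a = (\<Sum>k\<in>- infpt a. the_enat (a k))"

lemma finite_degree_strict_mono:
  fixes a b :: "'n::finite \<Rightarrow> enat"
  assumes "a \<le> b" "a \<noteq> b" "infpt a = infpt b"
  shows "finite_degree a < finite_degree b"
proof -
  obtain k where k: "a k \<noteq> b k" using assms(2) by (auto simp: fun_eq_iff)
  then have "k \<in> - infpt b" using assms(3) by (metis ComplI mem_infpt_iff)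
  moreover have fin: "\<exists>m n. a j = enat m \<and> b j = enat n \<and> m \<le> n" if "j \<in> - infpt b" for j
  proof -
    have "a j \<noteq> \<infinity>" "b j \<noteq> \<infinity>" using that assms(3) by (metis ComplD mem_infpt_iff)+
    moreover have "a j \<le> b j" using assms(1) by (simp add: le_fun_def)
    ultimately show ?thesis by auto
  qed
  ultimately show ?thesis unfolding finite_degree_def assms(3)
    by (intro sum_strict_mono_ex1) (use k in \<open>force+\<close>)
qed

text \<open>The base point of the Stanley set is \<open>a\<close> at its finite coordinates and \<open>d\<close> at its infinite ones.\<close>
lemma stanley_set_partial_box:
  fixes a :: "'n \<Rightarrow> enat" and d :: "'n \<Rightarrow> nat"
  assumes d: "\<forall>k. enat (d k) \<le> a k"
  shows "stanley_set {w. w \<le> a \<and> (\<forall>k. enat (d k) \<le> w k) \<and> (\<forall>k. k \<notin> infpt a \<longrightarrow> w k = a k)}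
    (generated {\<lambda>k. if k \<in> infpt a then \<infinity> else 0})"
    (is "stanley_set ?S (generated {?m})")
proof -
  define c where "c k = (if k \<in> infpt a then d k else the_enat (a k))" for k
  have ca: "enat (c k) = a k" if "k \<notin> infpt a" for k
    using that by (auto simp: c_def infpt_def)
  have gen: "t \<in> generated {?m} \<longleftrightarrow> (\<forall>k. k \<notin> infpt a \<longrightarrow> t k = 0)" for t
    by (auto simp: generated_def le_fun_def)
  have "?S = (\<lambda>t k. enat (c k) + t k) ` generated {?m}"
  proof (intro equalityI subsetI)
    fix w assume w: "w \<in> ?S"
    have "enat (c k) \<le> w k" for k
      using w ca[of k] by (cases "k \<in> infpt a") (auto simp: c_def)
    then have "w = (\<lambda>k. enat (c k) + (w k - enat (c k)))"
      by (intro ext) (metis add.commute add_diff_cancel_enat enat.distinct(2) le_iff_add)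
    moreover have "(\<lambda>k. w k - enat (c k)) \<in> generated {?m}"
      unfolding gen using w ca
      by (auto simp flip: zero_enat_def)
        (metis cancel_comm_monoid_add_class.diff_cancel idiff_enat_enat zero_enat_def)
    ultimately show "w \<in> (\<lambda>t k. enat (c k) + t k) ` generated {?m}"
      by (rule image_eqI)
  next
    fix w assume "w \<in> (\<lambda>t k. enat (c k) + t k) ` generated {?m}"
    then obtain t where t: "\<forall>k. k \<notin> infpt a \<longrightarrow> t k = 0" and w: "w = (\<lambda>k. enat (c k) + t k)"
      unfolding gen[symmetric] by blast
    have off: "w k = a k" if "k \<notin> infpt a" for k using that t w ca by simp
    have "w k \<le> a k" for k using off[of k] by (cases "k \<in> infpt a") (auto simp: infpt_def)
    moreover have "enat (d k) \<le> w k" for k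
      using off[of k] d by (cases "k \<in> infpt a") (auto simp: w c_def)
    ultimately show "w \<in> ?S" using off by (simp add: le_fun_def)
  qed
  then show ?thesis unfolding stanley_set_def
    by (intro exI[of _ c] exI[of _ ?m]) auto
qed

section \<open>From a maximal shelling to a shelling\<close>

locale maximal_shelling =
  fixes \<Gamma> :: "('n::finite \<Rightarrow> enat) set" and u :: "nat \<Rightarrow> 'n \<Rightarrow> enat" and r s :: nat
  assumes multicomplex: "multicomplex \<Gamma>"
    and enum: "bij_betw u {1..r} (maximal_elems \<Gamma>)"
    and s_range: "1 \<le> s" "s \<le> r"
    and initial: "\<forall>j\<in>{1..s}. infpt (u 1) = infpt (u j)"
    and one_component: "\<forall>i\<in>{s+1..r}. \<forall>v\<in>maximal_elems (generated (u ` {1..<i}) \<inter> generated {u i}).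
           \<exists>!k. v k \<noteq> u i k"
    and infpt_order: "\<forall>i j. s \<le> j \<and> j < i \<and> i \<le> r \<and> infpt (u j) \<subseteq> infpt (u i) \<longrightarrow>
           infpt (u j) = infpt (u i)"
begin

lemma below_some:
  assumes "a \<in> \<Gamma>" shows "\<exists>j\<in>{1..r}. a \<le> u j"
proof -
  obtain m where "m \<in> maximal_elems \<Gamma>" "a \<le> m"
    using assms multicomplex unfolding multicomplex_def by blast
  moreover have "m \<in> u ` {1..r}" using enum \<open>m \<in> maximal_elems \<Gamma>\<close> by (simp add: bij_betw_def)
  ultimately show ?thesis by blast
qed

lemma u_maximal: "j \<in> {1..r} \<Longrightarrow> u j \<in> maximal_elems \<Gamma>"
  using enum by (auto simp: bij_betw_def)

lemma u_mem: "j \<in> {1..r} \<Longrightarrow> u j \<in> \<Gamma>"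
  using u_maximal by (auto simp: maximal_elems_def)

lemma down: "a \<in> \<Gamma> \<Longrightarrow> b \<le> a \<Longrightarrow> b \<in> \<Gamma>"
  using multicomplex unfolding multicomplex_def by blast

text \<open>The first \<open>s\<close> maximal facets form one block: they share their infinite part, but can intersect in
any way, so the facets below them have to be arranged together by degree. Every later maximal facet
is a block of its own.\<close>
definition block :: "('n \<Rightarrow> enat) \<Rightarrow> nat" where
  "block a = (LEAST j. s \<le> j \<and> a \<in> generated (u ` {1..j}))"

lemma block_props:
  assumes "a \<in> \<Gamma>"
  shows "s \<le> block a" "block a \<le> r" "a \<in> generated (u ` {1..block a})"
proof -
  have P: "s \<le> r \<and> a \<in> generated (u ` {1..r})"
    using below_some[OF assms] s_range by (auto simp: generated_def)
  show "s \<le> block a" "a \<in> generated (u ` {1..block a})"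
    using LeastI[of "\<lambda>j. s \<le> j \<and> a \<in> generated (u ` {1..j})", OF P] by (auto simp: block_def)
  show "block a \<le> r" unfolding block_def using P by (rule Least_le)
qed

lemma block_le_iff:
  assumes "a \<in> \<Gamma>" "s \<le> j"
  shows "block a \<le> j \<longleftrightarrow> a \<in> generated (u ` {1..j})"
proof
  assume "block a \<le> j"
  then have "generated (u ` {1..block a}) \<subseteq> generated (u ` {1..j})"
    by (intro generated_mono image_mono) auto
  then show "a \<in> generated (u ` {1..j})" using block_props(3)[OF assms(1)] by blast
next
  assume "a \<in> generated (u ` {1..j})"
  then show "block a \<le> j" unfolding block_def using assms(2) by (intro Least_le) auto
qed

lemma block_mono: "a \<in> \<Gamma> \<Longrightarrow> b \<le> a \<Longrightarrow> block b \<le> block a"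
  using block_le_iff[OF down, of a b "block a"] block_props[of a] generated_mono_le by blast

lemma infpt_initial: "j \<in> {1..s} \<Longrightarrow> infpt (u j) = infpt (u s)"
  using initial s_range by (metis atLeastAtMost_iff order_refl)

lemma block_u:
  assumes "j \<in> {1..r}" shows "block (u j) = max j s"
proof (rule antisym)
  show "block (u j) \<le> max j s"
    unfolding block_le_iff[OF u_mem[OF assms] max.cobounded2]
    using assms by (auto simp: generated_def intro!: bexI[of _ j])
  obtain l where l: "l \<in> {1..block (u j)}" "u j \<le> u l"
    using block_props(3)[OF u_mem[OF assms]] by (auto simp: generated_def)
  then have "l \<in> {1..r}" using block_props(2)[OF u_mem[OF assms]] by auto
  then have "u j = u l" using l(2) u_maximal assms u_mem unfolding maximal_elems_def by force
  then have "j = l" using inj_onD[OF bij_betw_imp_inj_on[OF enum]] assms \<open>l \<in> {1..r}\<close> by blast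
  then show "max j s \<le> block (u j)" using l(1) block_props(1)[OF u_mem[OF assms]] by auto
qed

lemma facet_infpt:
  assumes "a \<in> facets \<Gamma>" shows "infpt a = infpt (u (block a))"
proof -
  have a: "a \<in> \<Gamma>" using assms by (simp add: facets_def)
  obtain j where j: "j \<in> {1..block a}" "a \<le> u j"
    using block_props(3)[OF a] by (auto simp: generated_def)
  then have jr: "j \<in> {1..r}" using block_props(2)[OF a] by auto
  then have inf: "infpt a = infpt (u j)" using assms j(2) u_maximal by (auto simp: facets_def)
  have "block a \<le> max j s" using block_mono[OF u_mem[OF jr] j(2)] block_u[OF jr] by simp
  then have "j = block a \<or> block a = s \<and> j \<in> {1..s}"
    using j(1) block_props(1)[OF a] by (cases "j \<le> s") auto
  then show ?thesis using inf infpt_initial by metis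
qed

text \<open>If a maximal facet above \<open>a\<close> comes after the block of \<open>a\<close>, then its infinite part contains that of
the block, and the condition on infinite parts in a maximal shelling makes the two equal. Otherwise
it belongs to the block of \<open>a\<close>, whose maximal facets all have the same infinite part.\<close>
lemma facetI:
  assumes a: "a \<in> \<Gamma>" and inf: "infpt a = infpt (u (block a))"
  shows "a \<in> facets \<Gamma>"
  unfolding facets_def
proof (intro CollectI conjI ballI impI a)
  fix m assume m: "m \<in> maximal_elems \<Gamma>" "a \<le> m"
  then obtain l where l: "l \<in> {1..r}" "m = u l"
    using bij_betw_imp_surj_on[OF enum] by blast
  have sub: "infpt a \<subseteq> infpt (u l)" using infpt_mono m(2) l(2) by blast
  have le: "block a \<le> max l s" using block_mono[OF u_mem[OF l(1)]] m(2) l block_u[OF l(1)] by simp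
  show "infpt a = infpt m"
  proof (cases "l \<le> s")
    case True
    then have "block a = s" using le block_props(1)[OF a] by simp
    then show ?thesis using inf infpt_initial[of l] l True by simp
  next
    case False
    then have "block a = l \<or> block a < l" using le by auto
    then show ?thesis
      using infpt_order block_props(1)[OF a] l sub inf by auto
  qed
qed

text \<open>In the initial block the lower bound \<open>d\<close> is \<open>0\<close>, because there is no block before it; in a later
block it is the bound obtained from the ceilings of the intersection with the earlier maximal
facets.\<close>
lemma block_fibre_is_box:
  assumes a: "a \<in> \<Gamma>"
  shows "\<exists>d :: 'n \<Rightarrow> nat. \<forall>w\<le>a. block w = block a \<longleftrightarrow> (\<forall>k. enat (d k) \<le> w k)"
proof (cases "block a = s")
  case True
  have "block w = block a" if "w \<le> a" for w
    using block_mono[OF a that] block_props(1)[OF down[OF a that]] True by simp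
  then show ?thesis by (intro exI[of _ "\<lambda>_. 0"]) (metis i0_lb zero_enat_def)
next
  case False
  let ?b = "block a"
  have b: "s < ?b" "?b \<le> r" using False block_props[OF a] by auto
  have prev: "{1..<?b} = {1..?b - 1}" by auto
  have new: "block w = ?b \<longleftrightarrow> w \<notin> generated (u ` {1..<?b})" if "w \<le> a" for w
    using block_le_iff[OF down[OF a that], of "?b - 1"] block_mono[OF a that] b
    unfolding prev by linarith
  have au: "a \<le> u ?b"
  proof -
    obtain j where j: "j \<in> {1..?b}" "a \<le> u j"
      using block_props(3)[OF a] by (auto simp: generated_def)
    moreover have "j \<notin> {1..<?b}" using new[of a] j(2) by (auto simp: generated_def)
    ultimately show ?thesis by (cases "j = ?b") auto
  qed
  have "?b \<in> {s+1..r}" using b by simp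
  then obtain d :: "'n \<Rightarrow> nat"
    where d: "\<forall>w\<le>u ?b. w \<notin> generated (u ` {1..<?b}) \<longleftrightarrow> (\<forall>k. enat (d k) \<le> w k)"
    using complement_below_is_box[OF finite_imageI[OF finite_atLeastLessThan] bspec[OF one_component]]
    by blast
  have "block w = ?b \<longleftrightarrow> (\<forall>k. enat (d k) \<le> w k)" if "w \<le> a" for w
    using new[OF that] d[rule_format, OF order_trans[OF that au]] by simp
  then show ?thesis by blast
qed

lemma finite_facets: "finite (facets \<Gamma>)"
proof (rule finite_subset)
  show "facets \<Gamma> \<subseteq> (\<Union>j\<in>{1..r}. {a. a \<le> u j \<and> infpt a = infpt (u j)})"
  proof
    fix a assume a: "a \<in> facets \<Gamma>"
    then obtain j where j: "j \<in> {1..r}" "a \<le> u j"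
      using below_some[of a] unfolding facets_def by blast
    then have "infpt a = infpt (u j)" using a u_maximal[OF j(1)] by (auto simp: facets_def)
    then show "a \<in> (\<Union>j\<in>{1..r}. {a. a \<le> u j \<and> infpt a = infpt (u j)})" using j by blast
  qed
qed (simp add: finite_below_same_infpt)

text \<open>The set \<open>E\<close> stands for the facets listed before \<open>a\<close>: all facets of earlier blocks, and those of the
same block in order of degree. Let \<open>w \<le> a\<close>. If \<open>w\<close> violates the bound \<open>d\<close>, then it lies in an
earlier block and hence below one of the maximal facets already listed. If \<open>w\<close> respects \<open>d\<close> but is
smaller than \<open>a\<close> at a finite coordinate, then lowering \<open>a\<close> there by one gives a facet of the same
block and of smaller degree that still lies above \<open>w\<close>. Conversely, if \<open>w\<close> respects \<open>d\<close> and agrees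
with \<open>a\<close> at the finite coordinates, a listed facet above \<open>w\<close> would be in the block of \<open>a\<close>, lie above
\<open>a\<close> itself, and so have larger degree than \<open>a\<close>.\<close>
lemma new_part_of_facet:
  assumes a: "a \<in> facets \<Gamma>"
    and d: "\<forall>w\<le>a. block w = block a \<longleftrightarrow> (\<forall>k. enat (d k) \<le> w k)"
    and E: "E \<subseteq> facets \<Gamma>" "a \<notin> E"
    and before: "\<And>b. b \<in> facets \<Gamma> \<Longrightarrow> block b < block a \<Longrightarrow> b \<in> E"
      "\<And>b. b \<in> facets \<Gamma> \<Longrightarrow> block b = block a \<Longrightarrow> finite_degree b < finite_degree a \<Longrightarrow> b \<in> E"
    and after: "\<And>b. b \<in> E \<Longrightarrow> block b \<le> block a"
      "\<And>b. b \<in> E \<Longrightarrow> block b = block a \<Longrightarrow> finite_degree b \<le> finite_degree a"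
  shows "generated {a} - generated E =
    {w. w \<le> a \<and> (\<forall>k. enat (d k) \<le> w k) \<and> (\<forall>k. k \<notin> infpt a \<longrightarrow> w k = a k)}" (is "_ = ?S")
proof (intro equalityI subsetI)
  have a\<Gamma>: "a \<in> \<Gamma>" using a by (simp add: facets_def)
  {
    fix w assume w: "w \<in> generated {a} - generated E"
    then have wa: "w \<le> a" by (simp add: generated_def)
    have notE: "\<not> w \<le> b" if "b \<in> E" for b using w that by (auto simp: generated_def)
    have w\<Gamma>: "w \<in> \<Gamma>" using down[OF a\<Gamma> wa] .
    have blk: "block w = block a"
    proof (rule ccontr)
      assume "block w \<noteq> block a"
      then have lt: "block w < block a" using block_mono[OF a\<Gamma> wa] by simp
      obtain j where j: "j \<in> {1..block w}" "w \<le> u j"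
        using block_props(3)[OF w\<Gamma>] by (auto simp: generated_def)
      then have jr: "j \<in> {1..r}" using block_props(2)[OF w\<Gamma>] by auto
      have "u j \<in> facets \<Gamma>"
        using u_mem[OF jr] u_maximal[OF jr] by (auto simp: facets_def maximal_elems_def)
      moreover have "block (u j) < block a"
        using block_u[OF jr] j(1) lt block_props(1)[OF w\<Gamma>] by auto
      ultimately show False using before(1) notE j(2) by blast
    qed
    then have dw: "\<forall>k. enat (d k) \<le> w k" using d wa by blast
    moreover have "w k = a k" if k: "k \<notin> infpt a" for k
    proof (rule ccontr)
      assume ne: "w k \<noteq> a k"
      obtain n where n: "a k = enat n" using k by (auto simp: infpt_def)
      have "w k < enat n" using ne wa n by (metis le_fun_def order.not_eq_order_implies_strict)
      then obtain p where p: "w k = enat p" "p < n" by (cases "w k") auto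
      let ?b = "a(k := enat (n - 1))"
      have wb: "w \<le> ?b" using wa p by (auto simp: le_fun_def)
      have ba: "?b \<le> a" "?b \<noteq> a" using n p by (auto simp: le_fun_def fun_eq_iff)
      have inf: "infpt ?b = infpt a" using n by (auto simp: infpt_def)
      have "enat (d k) \<le> ?b k" for k using dw le_funD[OF wb, of k] order_trans by blast
      then have bb: "block ?b = block a" using d[rule_format, OF ba(1)] by blast
      have "?b \<in> facets \<Gamma>"
        using facetI[OF down[OF a\<Gamma> ba(1)]] inf bb facet_infpt[OF a] by simp
      then have "?b \<in> E"
        using before(2) bb finite_degree_strict_mono[OF ba inf] by blast
      then show False using notE wb by blast
    qed
    ultimately show "w \<in> ?S" using wa by blast
  next
    fix w assume w: "w \<in> ?S"
    then have wa: "w \<le> a" and blk: "block w = block a" using d by auto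
    have "\<not> w \<le> b" if b: "b \<in> E" for b
    proof
      assume wb: "w \<le> b"
      have bf: "b \<in> facets \<Gamma>" and b\<Gamma>: "b \<in> \<Gamma>" using b E by (auto simp: facets_def)
      have bb: "block b = block a" using block_mono[OF b\<Gamma> wb] blk after(1)[OF b] by simp
      have inf: "infpt a = infpt b" using facet_infpt[OF a] facet_infpt[OF bf] bb by simp
      have "a k \<le> b k" for k
      proof (cases "k \<in> infpt a")
        case True
        then show ?thesis using inf by (metis enat_ord_simps(3) mem_infpt_iff)
      next
        case False
        then have "a k = w k" using w by simp
        then show ?thesis using le_funD[OF wb, of k] by simp
      qed
      then have "a \<le> b" by (simp add: le_fun_def)
      moreover have "a \<noteq> b" using b E(2) by blast
      ultimately have "finite_degree a < finite_degree b"
        using finite_degree_strict_mono inf by blast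
      then show False using after(2)[OF b bb] by simp
    qed
    then show "w \<in> generated {a} - generated E" using wa by (auto simp: generated_def)
  }
qed

lemma shellable: "shellable \<Gamma>"
proof -
  \<comment> \<open>The multiplier exceeds every degree, so the key compares first blocks and then degrees.\<close>
  define N where "N = Suc (Max (insert 0 (finite_degree ` facets \<Gamma>)))"
  define key where "key a = block a * N + finite_degree a" for a
  have deg: "finite_degree a < N" if "a \<in> facets \<Gamma>" for a
    using that finite_facets by (auto simp: N_def less_Suc_eq_le intro!: Max_ge)
  have block_key: "key b < key a" if "block b < block a" "b \<in> facets \<Gamma>" for a b
  proof -
    have "key b < Suc (block b) * N" using deg[OF that(2)] by (simp add: key_def)
    also have "\<dots> \<le> block a * N" using that(1) by (intro mult_le_mono1) simp
    finally show ?thesis by (simp add: key_def)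
  qed
  obtain R :: nat and a where a: "bij_betw a {1..R} (facets \<Gamma>)"
    and sorted: "\<forall>i\<in>{1..R}. \<forall>j\<in>{1..R}. i < j \<longrightarrow> key (a i) \<le> key (a j)"
    using finite_enumeration_by_key[OF finite_facets, of key] by blast
  have af: "a i \<in> facets \<Gamma>" if "i \<in> {1..R}" for i using a that by (auto simp: bij_betw_def)
  have block_le: "block (a i) \<le> block (a j)" if "i \<in> {1..R}" "j \<in> {1..R}" "i < j" for i j
    using sorted that block_key[of "a j" "a i"] af by (meson leD leI)
  define T :: "nat \<Rightarrow> ('n \<Rightarrow> enat) set" where
    "T i = generated {\<lambda>k. if k \<in> infpt (a i) then \<infinity> else 0}" for i
  have "stanley_set (generated {a i} - generated (a ` {1..<i})) (T i)" if i: "i \<in> {1..R}" for i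
  proof -
    have ai: "a i \<in> \<Gamma>" using af[OF i] by (simp add: facets_def)
    obtain d :: "'n \<Rightarrow> nat"
      where d: "\<forall>w\<le>a i. block w = block (a i) \<longleftrightarrow> (\<forall>k. enat (d k) \<le> w k)"
      using block_fibre_is_box[OF ai] by blast
    have smaller: "b \<in> a ` {1..<i}" if "b \<in> facets \<Gamma>" "key b < key (a i)" for b
    proof -
      obtain j where j: "j \<in> {1..R}" "b = a j"
        using bij_betw_imp_surj_on[OF a] \<open>b \<in> facets \<Gamma>\<close> by blast
      have "\<not> i \<le> j" using sorted i j that(2) by (metis leD le_neq_implies_less order_refl)
      then show ?thesis using j by auto
    qed
    have "generated {a i} - generated (a ` {1..<i}) =
      {w. w \<le> a i \<and> (\<forall>k. enat (d k) \<le> w k) \<and> (\<forall>k. k \<notin> infpt (a i) \<longrightarrow> w k = a i k)}"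
    proof (rule new_part_of_facet[OF af[OF i] d])
      show "a ` {1..<i} \<subseteq> facets \<Gamma>" using af i by auto
      show "a i \<notin> a ` {1..<i}" using inj_onD[OF bij_betw_imp_inj_on[OF a]] i by fastforce
      show "b \<in> a ` {1..<i}" if "b \<in> facets \<Gamma>" "block b < block (a i)" for b
        using smaller block_key that by blast
      show "b \<in> a ` {1..<i}" if "b \<in> facets \<Gamma>" "block b = block (a i)"
        "finite_degree b < finite_degree (a i)" for b
        using smaller that by (simp add: key_def)
      show "block b \<le> block (a i)" if "b \<in> a ` {1..<i}" for b
        using that block_le i by auto
      show "finite_degree b \<le> finite_degree (a i)"
        if b: "b \<in> a ` {1..<i}" "block b = block (a i)" for b
      proof -
        obtain j where "j \<in> {1..<i}" "b = a j" using b(1) by blast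
        then have "key b \<le> key (a i)" using sorted i by auto
        then show ?thesis using b(2) by (simp add: key_def)
      qed
    qed
    moreover have "\<forall>k. enat (d k) \<le> a i k" using d by blast
    ultimately show ?thesis using stanley_set_partial_box[of d "a i"] by (simp add: T_def)
  qed
  moreover have "T i = T j \<or> i > j" if ij: "i \<in> {1..R}" "j \<in> {1..R}" "T i \<subseteq> T j" for i j
  proof (cases "i < j")
    case True
    have "(\<lambda>k. if k \<in> infpt (a i) then \<infinity> else 0) \<in> T j"
      using ij(3) by (auto simp: T_def generated_def)
    then have sub: "infpt (a i) \<subseteq> infpt (a j)"
      by (force simp: T_def generated_def le_fun_def split: if_splits)
    have le: "block (a i) \<le> block (a j)" using block_le[OF ij(1,2) True] .
    have \<Gamma>: "a i \<in> \<Gamma>" "a j \<in> \<Gamma>" using af ij by (auto simp: facets_def)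
    have "infpt (a i) = infpt (a j)"
      using infpt_order sub le block_props[OF \<Gamma>(1)] block_props[OF \<Gamma>(2)]
        facet_infpt[OF af[OF ij(1)]] facet_infpt[OF af[OF ij(2)]]
      by (metis le_neq_implies_less)
    then show ?thesis by (simp add: T_def)
  qed (use that in auto)
  ultimately show ?thesis unfolding shellable_def using a by blast
qed

end

lemma maximal_shellable_imp_shellable:
  assumes "multicomplex \<Gamma>" "maximal_shellable \<Gamma>"
  shows "shellable (\<Gamma> :: ('n::finite \<Rightarrow> enat) set)"
proof -
  from assms(2) obtain r u s where "maximal_shelling \<Gamma> u r s"
    unfolding maximal_shellable_def maximal_shelling_def using assms(1) by blast
  then show ?thesis by (rule maximal_shelling.shellable)
qed

section \<open>Prime filtrations with cyclic steps\<close>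

lemma ring_as_module_simps [simp]:
  "carrier (ring_as_module R) = carrier R" "\<zero>\<^bsub>ring_as_module R\<^esub> = \<zero>\<^bsub>R\<^esub>"
  "add (ring_as_module R) = add R" "smult (ring_as_module R) = mult R"
  by (simp_all add: ring_as_module_def)

lemma module_ring_as_module:
  assumes "cring R" shows "Module.module R (ring_as_module R)"
proof -
  interpret cring R by fact
  have "abelian_group (ring_as_module R)"
    by (rule abelian_groupI) (auto simp: a_ac intro: l_neg)
  then show ?thesis
    by (intro moduleI) (auto simp: is_cring l_distr r_distr m_assoc)
qed

lemma submodule_of_ideal:
  assumes "cring R" "ideal J R" shows "submodule J R (ring_as_module R)"
proof -
  interpret cring R by fact
  interpret J: ideal J R by fact
  have inv: "\<ominus>\<^bsub>ring_as_module R\<^esub> a = \<ominus>\<^bsub>R\<^esub> a" for a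
    unfolding a_inv_def m_inv_def by simp
  show ?thesis
    by (rule module.submoduleI[OF module_ring_as_module[OF assms(1)]])
      (auto simp: inv J.I_l_closed)
qed

text \<open>The fractions \<open>1/1\<close> and \<open>0/1\<close> differ: if \<open>w\<close> made them equal, then \<open>w = 0\<close>, which lies in \<open>P\<close>.\<close>
lemma prime_in_Supp_ring:
  assumes "cring R" "primeideal P R"
  shows "P \<in> Supp R (ring_as_module R)"
proof -
  interpret cring R by fact
  interpret P: primeideal P R by fact
  let ?M = "ring_as_module R"
  let ?E = "fraction_rel R ?M P"
  have one: "\<one>\<^bsub>R\<^esub> \<in> carrier R - P" using P.one_imp_carrier P.I_notcarr by auto
  have "?E `` {(\<one>\<^bsub>R\<^esub>, \<one>\<^bsub>R\<^esub>)} \<noteq> ?E `` {(\<zero>\<^bsub>R\<^esub>, \<one>\<^bsub>R\<^esub>)}"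
  proof
    assume eq: "?E `` {(\<one>\<^bsub>R\<^esub>, \<one>\<^bsub>R\<^esub>)} = ?E `` {(\<zero>\<^bsub>R\<^esub>, \<one>\<^bsub>R\<^esub>)}"
    have "(\<one>\<^bsub>R\<^esub>, \<one>\<^bsub>R\<^esub>) \<in> ?E `` {(\<one>\<^bsub>R\<^esub>, \<one>\<^bsub>R\<^esub>)}"
      using one by (auto simp: fraction_rel_def)
    then have "((\<zero>\<^bsub>R\<^esub>, \<one>\<^bsub>R\<^esub>), (\<one>\<^bsub>R\<^esub>, \<one>\<^bsub>R\<^esub>)) \<in> ?E" unfolding eq by blast
    then obtain w where "w \<in> carrier R - P" "w \<otimes>\<^bsub>R\<^esub> (\<one>\<^bsub>R\<^esub> \<otimes>\<^bsub>R\<^esub> \<zero>\<^bsub>R\<^esub>) = w \<otimes>\<^bsub>R\<^esub> (\<one>\<^bsub>R\<^esub> \<otimes>\<^bsub>R\<^esub> \<one>\<^bsub>R\<^esub>)"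
      by (auto simp: fraction_rel_def)
    then show False using P.zero_closed by auto
  qed
  moreover have "?E `` {(\<one>\<^bsub>R\<^esub>, \<one>\<^bsub>R\<^esub>)} \<in> localization R ?M P"
    unfolding localization_def using one by (intro quotientI) simp
  ultimately show ?thesis using assms(2) unfolding Supp_def by auto
qed

lemma (in ideal) coset_eq_iff:
  assumes "a \<in> carrier R" "b \<in> carrier R"
  shows "I +> a = I +> b \<longleftrightarrow> a \<ominus> b \<in> I"
  using quotient_eq_iff_same_a_r_cos[OF is_ideal assms] by blast

lemma (in ideal) mem_coset_iff:
  assumes "a \<in> carrier R" "b \<in> carrier R"
  shows "a \<in> I +> b \<longleftrightarrow> a \<ominus> b \<in> I"
proof -
  have "a \<in> I +> b \<longleftrightarrow> I +> a = I +> b"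
    using a_rcos_self[OF assms(1)] a_repr_independence[OF _ assms(2) a_subgroup] by metis
  then show ?thesis using coset_eq_iff assms by simp
qed

lemma (in ideal) scalar_coset:
  assumes "c \<in> carrier R" "b \<in> carrier R"
  shows "(\<Union>z\<in>I +> b. I +> (c \<otimes> z)) = I +> (c \<otimes> b)"
proof -
  have "I +> (c \<otimes> z) = I +> (c \<otimes> b)" if z: "z \<in> I +> b" for z
  proof -
    have zc: "z \<in> carrier R" using z a_r_coset_subset_G[OF a_subset assms(2)] by blast
    have "c \<otimes> z \<ominus> c \<otimes> b = c \<otimes> (z \<ominus> b)"
      using assms zc by (simp add: minus_eq r_distr r_minus)
    moreover have "z \<ominus> b \<in> I" using z mem_coset_iff[OF zc assms(2)] by simp
    ultimately show ?thesis using coset_eq_iff assms zc I_l_closed by simp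
  qed
  moreover have "b \<in> I +> b" using a_rcos_self[OF assms(2)] .
  ultimately show ?thesis by blast
qed

lemma carrier_quot_module:
  "carrier (quot_module ((ring_as_module R)\<lparr>carrier := L\<rparr>) N) = (\<lambda>z. N +>\<^bsub>R\<^esub> z) ` L"
  by (auto simp: quot_module_def A_RCOSETS_def RCOSETS_def a_r_coset_def r_coset_def)

lemma add_quot_module:
  "A \<oplus>\<^bsub>quot_module ((ring_as_module R)\<lparr>carrier := L\<rparr>) N\<^esub> B = A <+>\<^bsub>R\<^esub> B"
  by (simp add: quot_module_def set_add_def set_mult_def)

lemma smult_quot_module:
  "c \<odot>\<^bsub>quot_module ((ring_as_module R)\<lparr>carrier := L\<rparr>) N\<^esub> A = (\<Union>z\<in>A. N +>\<^bsub>R\<^esub> (c \<otimes>\<^bsub>R\<^esub> z))"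
  by (simp add: quot_module_def a_r_coset_def r_coset_def)

text \<open>This brings a quotient of the whole ring into the form of the three preceding rules.\<close>
lemma ring_as_module_carrier: "ring_as_module R = (ring_as_module R)\<lparr>carrier := carrier R\<rparr>"
  by (simp add: ring_as_module_def)

text \<open>If \<open>L = N + R x\<close>, then \<open>L/N\<close> is cyclic and isomorphic to \<open>R\<close> modulo the annihilator \<open>P\<close> of the class
of \<open>x\<close>. The isomorphism sends a coset of \<open>N\<close> to the set of all scalars that multiply \<open>x\<close> into that
coset; this set is a coset of \<open>P\<close>, and no representatives have to be chosen.\<close>
lemma cyclic_subquotient:
  assumes R: "cring R" and N: "ideal N R" and L: "ideal L R" and x: "x \<in> L"
    and gen: "\<forall>z\<in>L. \<exists>p\<in>carrier R. \<exists>n\<in>N. z = n \<oplus>\<^bsub>R\<^esub> p \<otimes>\<^bsub>R\<^esub> x"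
    and P: "ideal P R" "P = {p \<in> carrier R. p \<otimes>\<^bsub>R\<^esub> x \<in> N}"
  shows "module_isomorphic R (quot_module ((ring_as_module R)\<lparr>carrier := L\<rparr>) N)
    (quot_module (ring_as_module R) P)"
proof -
  interpret cring R by fact
  interpret N: ideal N R by fact
  interpret L: ideal L R by fact
  interpret P: ideal P R by fact
  let ?M = "quot_module ((ring_as_module R)\<lparr>carrier := L\<rparr>) N"
  let ?Q = "quot_module ((ring_as_module R)\<lparr>carrier := carrier R\<rparr>) P"
  define f where "f A = {p \<in> carrier R. p \<otimes>\<^bsub>R\<^esub> x \<in> A}" for A
  have xc: "x \<in> carrier R" using x L.Icarr by blast
  have diff: "p \<otimes>\<^bsub>R\<^esub> x \<ominus>\<^bsub>R\<^esub> q \<otimes>\<^bsub>R\<^esub> x = (p \<ominus>\<^bsub>R\<^esub> q) \<otimes>\<^bsub>R\<^esub> x"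
    if "p \<in> carrier R" "q \<in> carrier R" for p q
    using that xc by (simp add: minus_eq l_distr l_minus)
  have memP: "p \<in> P \<longleftrightarrow> p \<otimes>\<^bsub>R\<^esub> x \<in> N" if "p \<in> carrier R" for p
    using P(2) that by blast
  have f: "f (N +>\<^bsub>R\<^esub> (q \<otimes>\<^bsub>R\<^esub> x)) = P +>\<^bsub>R\<^esub> q" if q: "q \<in> carrier R" for q
  proof -
    have "p \<in> f (N +>\<^bsub>R\<^esub> (q \<otimes>\<^bsub>R\<^esub> x)) \<longleftrightarrow> p \<in> P +>\<^bsub>R\<^esub> q" if p: "p \<in> carrier R" for p
      unfolding f_def using N.mem_coset_iff[of "p \<otimes>\<^bsub>R\<^esub> x" "q \<otimes>\<^bsub>R\<^esub> x"] P.mem_coset_iff[OF p q]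
        diff[OF p q] memP[of "p \<ominus>\<^bsub>R\<^esub> q"] p q xc by simp
    moreover have "P +>\<^bsub>R\<^esub> q \<subseteq> carrier R" using a_r_coset_subset_G[OF P.a_subset q] .
    ultimately show ?thesis unfolding f_def by blast
  qed
  have carM: "carrier ?M = (\<lambda>q. N +>\<^bsub>R\<^esub> (q \<otimes>\<^bsub>R\<^esub> x)) ` carrier R"
  proof -
    have "\<exists>q\<in>carrier R. N +>\<^bsub>R\<^esub> z = N +>\<^bsub>R\<^esub> (q \<otimes>\<^bsub>R\<^esub> x)" if z: "z \<in> L" for z
    proof -
      obtain q n where q: "q \<in> carrier R" "n \<in> N" "z = n \<oplus>\<^bsub>R\<^esub> q \<otimes>\<^bsub>R\<^esub> x" using gen z by blast
      then have "z \<in> N +>\<^bsub>R\<^esub> (q \<otimes>\<^bsub>R\<^esub> x)"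
        using a_rcosI[OF q(2) N.a_subset, of "q \<otimes>\<^bsub>R\<^esub> x"] xc by simp
      then show ?thesis
        using a_repr_independence[OF _ m_closed[OF q(1) xc] N.a_subgroup] q(1) by metis
    qed
    then show ?thesis unfolding carrier_quot_module using x L.I_l_closed by force
  qed
  have carQ: "carrier ?Q = (\<lambda>q. P +>\<^bsub>R\<^esub> q) ` carrier R" by (rule carrier_quot_module)
  have "bij_betw f (carrier ?M) (carrier ?Q)"
  proof (rule bij_betw_imageI)
    show "inj_on f (carrier ?M)"
      unfolding carM
    proof (intro inj_onI, elim imageE)
      fix A B p q assume A: "A = N +>\<^bsub>R\<^esub> (p \<otimes>\<^bsub>R\<^esub> x)" and B: "B = N +>\<^bsub>R\<^esub> (q \<otimes>\<^bsub>R\<^esub> x)"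
        and p: "p \<in> carrier R" and q: "q \<in> carrier R" and eq: "f A = f B"
      have "P +>\<^bsub>R\<^esub> p = P +>\<^bsub>R\<^esub> q" using eq unfolding A B f[OF p] f[OF q] .
      then have "(p \<ominus>\<^bsub>R\<^esub> q) \<otimes>\<^bsub>R\<^esub> x \<in> N"
        unfolding P.coset_eq_iff[OF p q] memP[OF minus_closed[OF p q]] .
      then show "A = B"
        unfolding A B N.coset_eq_iff[OF m_closed[OF p xc] m_closed[OF q xc]] diff[OF p q] .
    qed
    show "f ` carrier ?M = carrier ?Q"
      unfolding carM carQ image_image by (rule image_cong) (auto simp: f)
  qed
  moreover have "f (A \<oplus>\<^bsub>?M\<^esub> B) = f A \<oplus>\<^bsub>?Q\<^esub> f B" if AB: "A \<in> carrier ?M" "B \<in> carrier ?M" for A B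
  proof -
    obtain p q where pq: "p \<in> carrier R" "A = N +>\<^bsub>R\<^esub> (p \<otimes>\<^bsub>R\<^esub> x)"
        "q \<in> carrier R" "B = N +>\<^bsub>R\<^esub> (q \<otimes>\<^bsub>R\<^esub> x)"
      using AB unfolding carM by blast
    have "A <+>\<^bsub>R\<^esub> B = N +>\<^bsub>R\<^esub> ((p \<oplus>\<^bsub>R\<^esub> q) \<otimes>\<^bsub>R\<^esub> x)"
      using pq xc by (simp add: N.a_rcos_sum l_distr)
    then show ?thesis unfolding add_quot_module using pq f P.a_rcos_sum by simp
  qed
  moreover have "f (c \<odot>\<^bsub>?M\<^esub> A) = c \<odot>\<^bsub>?Q\<^esub> f A" if c: "c \<in> carrier R" and "A \<in> carrier ?M" for c A
  proof -
    obtain p where p: "p \<in> carrier R" "A = N +>\<^bsub>R\<^esub> (p \<otimes>\<^bsub>R\<^esub> x)"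
      using \<open>A \<in> carrier ?M\<close> unfolding carM by blast
    have "c \<odot>\<^bsub>?M\<^esub> A = N +>\<^bsub>R\<^esub> ((c \<otimes>\<^bsub>R\<^esub> p) \<otimes>\<^bsub>R\<^esub> x)"
      unfolding smult_quot_module p(2) using N.scalar_coset c p(1) xc by (simp add: m_assoc)
    then show ?thesis
      unfolding smult_quot_module using p c f P.scalar_coset by simp
  qed
  ultimately show ?thesis
    unfolding module_isomorphic_def ring_as_module_carrier[of R, symmetric]
    by (intro exI[of _ f]) simp
qed

lemma (in ideal) coset_mem_image_iff:
  assumes J: "ideal J R" "I \<subseteq> J" and z: "z \<in> carrier R"
  shows "I +> z \<in> (+>) I ` J \<longleftrightarrow> z \<in> J"
proof
  interpret J: ideal J R by fact
  assume "I +> z \<in> (+>) I ` J"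
  then obtain j where j: "j \<in> J" "I +> z = I +> j" by blast
  then have "z \<ominus> j \<in> J" using coset_eq_iff[OF z J.Icarr] J(2) by blast
  then have "(z \<ominus> j) \<oplus> j \<in> J" using j(1) by (rule J.a_closed)
  then show "z \<in> J" using z J.Icarr[OF j(1)] by (simp add: minus_eq a_assoc l_neg)
qed auto

lemma (in ideal) primeideal_quotient:
  assumes "cring R" and J: "primeideal J R" "I \<subseteq> J"
  shows "primeideal ((+>) I ` J) (R Quot I)"
proof -
  interpret cring R by fact
  interpret J: primeideal J R by fact
  have carr: "carrier (R Quot I) = (+>) I ` carrier R"
    by (auto simp: FactRing_simps)
  have mem: "I +> z \<in> (+>) I ` J \<longleftrightarrow> z \<in> J" if "z \<in> carrier R" for z
    using coset_mem_image_iff[OF J.is_ideal J(2) that] .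
  show ?thesis
  proof (rule primeidealI)
    show "ideal ((+>) I ` J) (R Quot I)"
      by (rule ring_ideal_imp_quot_ideal[OF is_ideal J.is_ideal])
    show "cring (R Quot I)" by (rule quotient_is_cring) (rule is_cring)
    have "\<one> \<notin> J" using J.one_imp_carrier J.I_notcarr by auto
    then show "carrier (R Quot I) \<noteq> (+>) I ` J" unfolding carr using mem[of \<one>] by auto
  next
    fix a b assume "a \<in> carrier (R Quot I)" "b \<in> carrier (R Quot I)"
      and ab: "a \<otimes>\<^bsub>R Quot I\<^esub> b \<in> (+>) I ` J"
    then obtain p q where pq: "p \<in> carrier R" "a = I +> p" "q \<in> carrier R" "b = I +> q"
      unfolding carr by blast
    have "a \<otimes>\<^bsub>R Quot I\<^esub> b = I +> (p \<otimes> q)"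
      using pq by (simp add: FactRing_def rcoset_mult_add)
    then have "p \<otimes> q \<in> J" using ab mem pq by simp
    then show "a \<in> (+>) I ` J \<or> b \<in> (+>) I ` J"
      using J.I_prime[OF pq(1,3)] pq by blast
  qed
qed

text \<open>A chain of ideals of \<open>R\<close> from \<open>I\<close> up to \<open>R\<close> whose successive quotients are cyclic, with prime
annihilators \<open>Q i\<close>, becomes a prime filtration of \<open>R/I\<close> after reduction modulo \<open>I\<close>. As all ideals
involved contain \<open>I\<close>, membership of a coset in a reduced ideal can be tested on a representative,
and inclusions between the primes are the same before and after reduction.\<close>
lemma pretty_clean_quotient_ring:
  fixes R (structure) and r :: nat
  assumes R: "cring R"
    and bot: "J 0 = I" and top: "J r = carrier R" and id: "\<forall>i\<le>r. ideal (J i) R"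
    and sub: "\<forall>i\<in>{1..r}. J (i - 1) \<subseteq> J i"
    and y: "\<forall>i\<in>{1..r}. y i \<in> J i - J (i - 1)"
    and gen: "\<forall>i\<in>{1..r}. \<forall>z\<in>J i. \<exists>p\<in>carrier R. \<exists>n\<in>J (i - 1). z = n \<oplus> p \<otimes> y i"
    and prime: "\<forall>i\<in>{1..r}. primeideal (Q i) R"
    and ann: "\<forall>i\<in>{1..r}. Q i = {p \<in> carrier R. p \<otimes> y i \<in> J (i - 1)}"
    and order: "\<forall>i\<in>{1..r}. \<forall>j\<in>{1..r}. i < j \<and> Q i \<subseteq> Q j \<longrightarrow> Q i = Q j"
  shows "pretty_clean_ring (R Quot I)"
proof -
  interpret cring R by fact
  interpret I: ideal I R using id[rule_format, of 0] bot by simp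
  have IJ: "I \<subseteq> J i" if "i \<le> r" for i
    using that
  proof (induction i)
    case 0
    then show ?case by (simp add: bot)
  next
    case (Suc i)
    have "J (Suc i - 1) \<subseteq> J (Suc i)" using sub Suc.prems by (intro bspec[OF sub]) auto
    then show ?case using Suc by simp
  qed
  have yc: "y i \<in> carrier R" if "i \<in> {1..r}" for i
    using y that id ideal.Icarr[of "J i" R "y i"] by auto
  have IQ: "I \<subseteq> Q i" if i: "i \<in> {1..r}" for i
  proof
    fix p assume p: "p \<in> I"
    have "i - 1 \<le> r" using i by auto
    then have "p \<otimes> y i \<in> J (i - 1)" using I.I_r_closed[OF p yc[OF i]] IJ by blast
    then show "p \<in> Q i" using ann i I.Icarr[OF p] by blast
  qed
  let ?A = "R Quot I"
  let ?M = "ring_as_module ?A"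
  let ?c = "(+>) I"
  have A: "cring ?A" by (rule I.quotient_is_cring) (rule is_cring)
  have carr: "carrier ?A = ?c ` carrier R" by (auto simp: FactRing_simps)
  have zeroA: "\<zero>\<^bsub>?A\<^esub> = I" by (simp add: FactRing_def)
  have mulA: "?c p \<otimes>\<^bsub>?A\<^esub> ?c q = ?c (p \<otimes> q)" if "p \<in> carrier R" "q \<in> carrier R" for p q
    using that by (simp add: FactRing_def I.rcoset_mult_add)
  have addA: "?c p \<oplus>\<^bsub>?A\<^esub> ?c q = ?c (p \<oplus> q)" if "p \<in> carrier R" "q \<in> carrier R" for p q
    using that by (simp add: FactRing_def I.a_rcos_sum)
  define F where "F i = ?c ` J i" for i
  define P where "P i = ?c ` Q i" for i
  have idF: "ideal (F i) ?A" if "i \<le> r" for i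
    unfolding F_def using ring_ideal_imp_quot_ideal[OF I.is_ideal] id that by blast
  have memF: "?c z \<in> F i \<longleftrightarrow> z \<in> J i" if "i \<le> r" "z \<in> carrier R" for i z
    unfolding F_def using I.coset_mem_image_iff[OF _ IJ] id that by blast
  have idQ: "ideal (Q i) R" if "i \<in> {1..r}" for i
    using prime that primeideal.axioms(1) by blast
  have memP: "?c z \<in> P i \<longleftrightarrow> z \<in> Q i" if "i \<in> {1..r}" "z \<in> carrier R" for i z
    unfolding P_def using I.coset_mem_image_iff[OF idQ IQ] that by blast
  have primeP: "primeideal (P i) ?A" if "i \<in> {1..r}" for i
    unfolding P_def using I.primeideal_quotient[OF is_cring _ IQ] prime that by blast
  have "prime_filtration ?A ?M r F P"
    unfolding prime_filtration_def
  proof (intro conjI ballI allI impI)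
    have "?c z = I" if "z \<in> I" for z using a_coset_join2[OF I.Icarr[OF that] I.a_subgroup that] .
    then have "?c ` I = (\<lambda>_. I) ` I" by (intro image_cong refl)
    then show "F 0 = {\<zero>\<^bsub>?M\<^esub>}"
      unfolding F_def bot using image_constant[OF I.zero_closed] by (simp add: zeroA)
    show "F r = carrier ?M" by (simp add: F_def top carr)
    show "submodule (F i) ?A ?M" if "i \<le> r" for i using submodule_of_ideal[OF A idF[OF that]] .
  next
    fix i assume i: "i \<in> {1..r}"
    then have ir: "i \<le> r" "i - 1 \<le> r" by auto
    have yi: "y i \<in> J i" "y i \<notin> J (i - 1)" using y i by auto
    have "?c (y i) \<in> F i" "?c (y i) \<notin> F (i - 1)"
      using memF[OF ir(1) yc[OF i]] memF[OF ir(2) yc[OF i]] yi by auto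
    moreover have "F (i - 1) \<subseteq> F i" unfolding F_def using sub i by blast
    ultimately show "F (i - 1) \<subset> F i" by blast
    show "P i \<in> Supp ?A ?M" by (rule prime_in_Supp_ring[OF A primeP[OF i]])
    show "module_isomorphic ?A (quot_module (?M\<lparr>carrier := F i\<rparr>) (F (i - 1))) (quot_module ?M (P i))"
    proof (rule cyclic_subquotient[OF A idF[OF ir(2)] idF[OF ir(1)]])
      show "?c (y i) \<in> F i" by fact
      show "ideal (P i) ?A" using primeP[OF i] primeideal.axioms(1) by blast
      show "\<forall>z\<in>F i. \<exists>p\<in>carrier ?A. \<exists>n\<in>F (i - 1). z = n \<oplus>\<^bsub>?A\<^esub> p \<otimes>\<^bsub>?A\<^esub> ?c (y i)"
      proof
        fix z assume "z \<in> F i"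
        then obtain w where w: "w \<in> J i" "z = ?c w" unfolding F_def by blast
        obtain p n where p: "p \<in> carrier R" "n \<in> J (i - 1)" "w = n \<oplus> p \<otimes> y i"
          using gen i w(1) by blast
        have "n \<in> carrier R" using ideal.Icarr[OF id[rule_format, OF ir(2)] p(2)] .
        then have "z = ?c n \<oplus>\<^bsub>?A\<^esub> ?c p \<otimes>\<^bsub>?A\<^esub> ?c (y i)"
          using p yc[OF i] w(2) mulA[OF p(1) yc[OF i]] addA[of n "p \<otimes> y i"] by simp
        moreover have "?c p \<in> carrier ?A" "?c n \<in> F (i - 1)" using p by (auto simp: carr F_def)
        ultimately show "\<exists>p\<in>carrier ?A. \<exists>n\<in>F (i - 1). z = n \<oplus>\<^bsub>?A\<^esub> p \<otimes>\<^bsub>?A\<^esub> ?c (y i)" by blast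
      qed
      show "P i = {p \<in> carrier ?A. p \<otimes>\<^bsub>?A\<^esub> ?c (y i) \<in> F (i - 1)}"
      proof -
        have iff: "?c p \<in> P i \<longleftrightarrow> ?c p \<otimes>\<^bsub>?A\<^esub> ?c (y i) \<in> F (i - 1)" if p: "p \<in> carrier R" for p
          using memP[OF i p] memF[OF ir(2) m_closed[OF p yc[OF i]]] mulA[OF p yc[OF i]]
            bspec[OF ann i] p by auto
        have "P i \<subseteq> ?c ` carrier R"
          unfolding P_def by (intro image_mono) (use ideal.Icarr[OF idQ[OF i]] in blast)
        then show ?thesis unfolding carr using iff by blast
      qed
    qed
  qed
  moreover have "P i = P j" if ij: "i \<in> {1..r}" "j \<in> {1..r}" "i < j \<and> P i \<subseteq> P j" for i j
  proof -
    have "Q i \<subseteq> Q j"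
    proof
      fix q assume q: "q \<in> Q i"
      then have "q \<in> carrier R" by (rule ideal.Icarr[OF idQ[OF ij(1)]])
      moreover have "?c q \<in> P j" using q ij(3) unfolding P_def by blast
      ultimately show "q \<in> Q j" using memP[OF ij(2)] by blast
    qed
    then have "Q i = Q j" using order ij by blast
    then show ?thesis unfolding P_def by simp
  qed
  ultimately show ?thesis
    unfolding pretty_clean_ring_def pretty_clean_def
    by (intro conjI module_ring_as_module[OF A] exI[of _ r] exI[of _ F] exI[of _ P]) auto
qed

section \<open>Monomial ideals\<close>

abbreviation exponent :: "('n \<Rightarrow>\<^sub>0 nat) \<Rightarrow> 'n \<Rightarrow> enat" where
  "exponent a \<equiv> \<lambda>i. enat (Poly_Mapping.lookup a i)"

lemma sum_of_terms:
  "p = (\<Sum>a\<in>Poly_Mapping.keys p. Poly_Mapping.single a (Poly_Mapping.lookup p a))"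
  by (rule poly_mapping_eqI)
    (auto simp: lookup_sum lookup_single when_def in_keys_iff)

lemma lookup_times_keys:
  fixes p q :: "'a::comm_monoid_add \<Rightarrow>\<^sub>0 'k::comm_semiring_0"
  shows "Poly_Mapping.lookup (p * q) k =
    (\<Sum>a\<in>Poly_Mapping.keys p. \<Sum>b\<in>Poly_Mapping.keys q.
      if a + b = k then Poly_Mapping.lookup p a * Poly_Mapping.lookup q b else 0)"
proof -
  have "p * q = (\<Sum>a\<in>Poly_Mapping.keys p. \<Sum>b\<in>Poly_Mapping.keys q.
      Poly_Mapping.single (a + b) (Poly_Mapping.lookup p a * Poly_Mapping.lookup q b))"
    by (subst (1) sum_of_terms[of p], subst (1) sum_of_terms[of q])
      (simp add: sum_product mult_single)
  then show ?thesis
    by (simp add: lookup_sum lookup_single when_def)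
qed

lemma lookup_times_unique:
  fixes p q :: "'a::comm_monoid_add \<Rightarrow>\<^sub>0 'k::comm_semiring_0"
  assumes a: "a \<in> Poly_Mapping.keys p" and b: "b \<in> Poly_Mapping.keys q"
    and unique: "\<And>a' b'. a' \<in> Poly_Mapping.keys p \<Longrightarrow> b' \<in> Poly_Mapping.keys q \<Longrightarrow>
      a' + b' = a + b \<Longrightarrow> a' = a \<and> b' = b"
  shows "Poly_Mapping.lookup (p * q) (a + b) = Poly_Mapping.lookup p a * Poly_Mapping.lookup q b"
proof -
  let ?c = "Poly_Mapping.lookup p a * Poly_Mapping.lookup q b"
  have "Poly_Mapping.lookup (p * q) (a + b) =
    (\<Sum>a'\<in>Poly_Mapping.keys p. \<Sum>b'\<in>Poly_Mapping.keys q. if a' = a then if b' = b then ?c else 0 else 0)"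
    unfolding lookup_times_keys using unique by (intro sum.cong refl) auto
  also have "\<dots> = (\<Sum>a'\<in>Poly_Mapping.keys p.
      if a' = a then \<Sum>b'\<in>Poly_Mapping.keys q. if b' = b then ?c else 0 else 0)"
    by (intro sum.cong refl) auto
  also have "\<dots> = ?c" using a b by simp
  finally show ?thesis .
qed

lemma keys_times_monomial:
  fixes p :: "('n \<Rightarrow>\<^sub>0 nat) \<Rightarrow>\<^sub>0 'k::field"
  shows "Poly_Mapping.keys (p * Poly_Mapping.single b 1) = (\<lambda>a. a + b) ` Poly_Mapping.keys p"
proof
  show "Poly_Mapping.keys (p * Poly_Mapping.single b 1) \<subseteq> (\<lambda>a. a + b) ` Poly_Mapping.keys p"
    using keys_mult[of p "Poly_Mapping.single b 1"] by auto
  show "(\<lambda>a. a + b) ` Poly_Mapping.keys p \<subseteq> Poly_Mapping.keys (p * Poly_Mapping.single b 1)"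
  proof
    fix k assume "k \<in> (\<lambda>a. a + b) ` Poly_Mapping.keys p"
    then obtain a where a: "a \<in> Poly_Mapping.keys p" "k = a + b" by blast
    have "Poly_Mapping.lookup (p * Poly_Mapping.single b 1) (a + b)
        = Poly_Mapping.lookup p a * Poly_Mapping.lookup (Poly_Mapping.single b (1::'k)) b"
      by (rule lookup_times_unique) (use a in auto)
    then show "k \<in> Poly_Mapping.keys (p * Poly_Mapping.single b 1)"
      using a by (auto simp: in_keys_iff)
  qed
qed

text \<open>Numbering the variables makes the lexicographic order on finitely supported sequences available as a
monomial order.\<close>
lemma additive_injection_into_linear_order:
  "\<exists>h :: ('n::finite \<Rightarrow>\<^sub>0 nat) \<Rightarrow> (nat \<Rightarrow>\<^sub>0 nat). inj h \<and> (\<forall>a b. h (a + b) = h a + h b)"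
proof -
  obtain e :: "'n \<Rightarrow> nat" where e: "inj e"
    using finite_imp_inj_to_nat_seg[of "UNIV :: 'n set"] by blast
  define h :: "('n \<Rightarrow>\<^sub>0 nat) \<Rightarrow> (nat \<Rightarrow>\<^sub>0 nat)"
    where "h a = (\<Sum>i\<in>UNIV. Poly_Mapping.single (e i) (Poly_Mapping.lookup a i))" for a
  have "Poly_Mapping.lookup (h a) (e j) = Poly_Mapping.lookup a j" for a j
    using e by (simp add: h_def lookup_sum lookup_single when_def inj_eq)
  then have "inj h" by (intro injI poly_mapping_eqI) metis
  moreover have "h (a + b) = h a + h b" for a b
    by (simp add: h_def lookup_add single_add sum.distrib)
  ultimately show ?thesis by blast
qed

text \<open>The set \<open>Z\<close> is a face of the monoid of exponents. Among the exponents of \<open>p\<close> and \<open>q\<close> that lie in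
\<open>Z\<close>, take the largest ones for a monomial order. Any other pair of exponents with the same sum would
also lie in \<open>Z\<close>, since \<open>Z\<close> is a face, and would have a smaller sum. So the product of the two
leading coefficients cannot be cancelled.\<close>
lemma face_meets_product:
  fixes p q :: "('n::finite \<Rightarrow>\<^sub>0 nat) \<Rightarrow>\<^sub>0 'k::field"
  assumes face: "\<And>a b. a + b \<in> Z \<longleftrightarrow> a \<in> Z \<and> b \<in> Z"
    and p: "Poly_Mapping.keys p \<inter> Z \<noteq> {}" and q: "Poly_Mapping.keys q \<inter> Z \<noteq> {}"
  shows "Poly_Mapping.keys (p * q) \<inter> Z \<noteq> {}"
proof -
  obtain h :: "('n \<Rightarrow>\<^sub>0 nat) \<Rightarrow> (nat \<Rightarrow>\<^sub>0 nat)"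
    where h: "inj h" and add: "\<And>a b. h (a + b) = h a + h b"
    using additive_injection_into_linear_order by blast
  have "\<exists>a\<in>Poly_Mapping.keys f \<inter> Z. \<forall>a'\<in>Poly_Mapping.keys f \<inter> Z. h a' \<le> h a"
    if "Poly_Mapping.keys f \<inter> Z \<noteq> {}" for f :: "('n \<Rightarrow>\<^sub>0 nat) \<Rightarrow>\<^sub>0 'k"
  proof -
    have fin: "finite (h ` (Poly_Mapping.keys f \<inter> Z))" by simp
    have "Max (h ` (Poly_Mapping.keys f \<inter> Z)) \<in> h ` (Poly_Mapping.keys f \<inter> Z)"
      using that by (intro Max_in fin) auto
    then show ?thesis using Max_ge[OF fin] by force
  qed
  from this[OF p] this[OF q] obtain a b
    where a: "a \<in> Poly_Mapping.keys p" "a \<in> Z" "\<And>a'. a' \<in> Poly_Mapping.keys p \<Longrightarrow> a' \<in> Z \<Longrightarrow> h a' \<le> h a"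
      and b: "b \<in> Poly_Mapping.keys q" "b \<in> Z" "\<And>b'. b' \<in> Poly_Mapping.keys q \<Longrightarrow> b' \<in> Z \<Longrightarrow> h b' \<le> h b"
    by blast
  have "Poly_Mapping.lookup (p * q) (a + b) = Poly_Mapping.lookup p a * Poly_Mapping.lookup q b"
  proof (rule lookup_times_unique[OF a(1) b(1)])
    fix a' b' assume keys: "a' \<in> Poly_Mapping.keys p" "b' \<in> Poly_Mapping.keys q"
      and sum: "a' + b' = a + b"
    then have "a' \<in> Z" "b' \<in> Z" using face a(2) b(2) by metis+
    then have le: "h a' \<le> h a" "h b' \<le> h b" using keys a(3) b(3) by blast+
    have eq: "h a' + h b' = h a + h b" using sum add by metis
    have "h a' = h a"
    proof (rule ccontr)
      assume "h a' \<noteq> h a"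
      then have "h a' + h b' < h a + h b" using le by (intro add_less_le_mono) auto
      then show False using eq by simp
    qed
    then have "a' = a" using h by (simp add: inj_eq)
    then show "a' = a \<and> b' = b" using sum by simp
  qed
  then have "a + b \<in> Poly_Mapping.keys (p * q)" using a(1) b(1) by (simp add: in_keys_iff)
  then show ?thesis using face a(2) b(2) by blast
qed

text \<open>The monomials form a basis of the polynomial ring, so the span of some of them is recognised by
supports.\<close>
lemma mem_monomial_ideal_iff:
  fixes p :: "('n, 'k::field) mpoly"
  shows "p \<in> monomial_ideal \<Delta> \<longleftrightarrow> (\<forall>a\<in>Poly_Mapping.keys p. exponent a \<notin> \<Delta>)"
proof -
  let ?scale = "\<lambda>(c::'k) (p :: ('n, 'k) mpoly). Poly_Mapping.single 0 c * p"
  interpret M: Modules.module ?scale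
    by unfold_locales (auto simp: algebra_simps single_add mult_single simp flip: mult.assoc)
  let ?B = "{Poly_Mapping.single a 1 | a. exponent a \<notin> \<Delta>} :: ('n, 'k) mpoly set"
  have "M.subspace {p. \<forall>a\<in>Poly_Mapping.keys p. exponent a \<notin> \<Delta>}"
  proof (rule M.subspaceI)
    fix x y :: "('n, 'k) mpoly"
    assume "x \<in> {p. \<forall>a\<in>Poly_Mapping.keys p. exponent a \<notin> \<Delta>}"
      "y \<in> {p. \<forall>a\<in>Poly_Mapping.keys p. exponent a \<notin> \<Delta>}"
    then show "x + y \<in> {p. \<forall>a\<in>Poly_Mapping.keys p. exponent a \<notin> \<Delta>}"
      using Poly_Mapping.keys_add[of x y] by auto
  next
    fix c :: 'k and x :: "('n, 'k) mpoly"
    assume "x \<in> {p. \<forall>a\<in>Poly_Mapping.keys p. exponent a \<notin> \<Delta>}"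
    then show "?scale c x \<in> {p. \<forall>a\<in>Poly_Mapping.keys p. exponent a \<notin> \<Delta>}"
      using keys_mult[of "Poly_Mapping.single 0 c" x] by (auto split: if_splits)
  qed auto
  then have "M.span ?B \<subseteq> {p. \<forall>a\<in>Poly_Mapping.keys p. exponent a \<notin> \<Delta>}"
    by (intro M.span_minimal) auto
  moreover have "p \<in> M.span ?B" if "\<forall>a\<in>Poly_Mapping.keys p. exponent a \<notin> \<Delta>"
  proof -
    have "Poly_Mapping.single a (Poly_Mapping.lookup p a) \<in> M.span ?B" if "a \<in> Poly_Mapping.keys p" for a
    proof -
      have "?scale (Poly_Mapping.lookup p a) (Poly_Mapping.single a 1) \<in> M.span ?B"
        using \<open>\<forall>a\<in>Poly_Mapping.keys p. exponent a \<notin> \<Delta>\<close> that by (intro M.span_scale M.span_base) blast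
      then show ?thesis by (simp add: mult_single)
    qed
    then show ?thesis by (subst sum_of_terms) (rule M.span_sum)
  qed
  ultimately show ?thesis unfolding monomial_ideal_def by blast
qed

definition down_closed :: "('n \<Rightarrow> enat) set \<Rightarrow> bool" where
  "down_closed \<Delta> \<longleftrightarrow> (\<forall>a\<in>\<Delta>. \<forall>b\<le>a. b \<in> \<Delta>)"

lemma down_closed_generated: "down_closed (generated A)"
  unfolding down_closed_def generated_def by (blast intro: order_trans)

lemma cring_poly_ring: "cring (poly_ring :: ('n, 'k::field) mpoly ring)"
  by (rule cring_from_type_algebra)

lemma poly_ring_simps [simp]:
  "carrier poly_ring = UNIV" "p \<otimes>\<^bsub>poly_ring\<^esub> q = p * q" "p \<oplus>\<^bsub>poly_ring\<^esub> q = p + q" "\<zero>\<^bsub>poly_ring\<^esub> = 0"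
  for p q :: "('n, 'k::field) mpoly"
  by (simp_all add: ring_of_type_algebra_def)

lemma ideal_monomial_ideal:
  assumes "down_closed \<Delta>"
  shows "ideal (monomial_ideal \<Delta> :: ('n, 'k::field) mpoly set) poly_ring"
proof -
  let ?I = "monomial_ideal \<Delta> :: ('n, 'k) mpoly set"
  interpret R: cring "poly_ring :: ('n, 'k) mpoly ring" by (rule cring_poly_ring)
  have mult: "p * q \<in> ?I" if "q \<in> ?I" for p q
    unfolding mem_monomial_ideal_iff
  proof
    fix k assume "k \<in> Poly_Mapping.keys (p * q)"
    then obtain a b where k: "k = a + b" "b \<in> Poly_Mapping.keys q" using keys_mult by blast
    have "exponent b \<le> exponent k" by (simp add: k le_fun_def lookup_add)
    then show "exponent k \<notin> \<Delta>"
      using assms that k(2) unfolding down_closed_def mem_monomial_ideal_iff by blast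
  qed
  have mult': "q * p \<in> ?I" if "q \<in> ?I" for p q
    using mult[OF that] by (simp only: mult.commute)
  have add: "p + q \<in> ?I" if "p \<in> ?I" "q \<in> ?I" for p q
    using that Poly_Mapping.keys_add[of p q] unfolding mem_monomial_ideal_iff by blast
  have "subgroup ?I (add_monoid poly_ring)"
  proof (rule R.add.subgroupI)
    have "0 \<in> ?I" by (simp add: mem_monomial_ideal_iff)
    then show "?I \<noteq> {}" by blast
    show "\<ominus>\<^bsub>poly_ring\<^esub> p \<in> ?I" if "p \<in> ?I" for p
    proof -
      have "\<ominus>\<^bsub>poly_ring\<^esub> p = - 1 * p"
        using R.sum_zero_eq_neg[of "- 1 * p" p] by simp
      then show ?thesis using mult[OF that] by metis
    qed
  qed (auto intro: add)
  then show ?thesis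
    by (rule idealI[OF R.ring_axioms]) (auto intro: mult mult')
qed

lemma mem_generated_indicator_iff:
  assumes "\<forall>i. m i \<in> {0, \<infinity>}"
  shows "t \<in> generated {m} \<longleftrightarrow> (\<forall>i. m i = 0 \<longrightarrow> t i = 0)"
proof
  assume "t \<in> generated {m}"
  then show "\<forall>i. m i = 0 \<longrightarrow> t i = 0" by (auto simp: generated_def le_fun_def) (metis i0_lb order_antisym)
next
  assume t: "\<forall>i. m i = 0 \<longrightarrow> t i = 0"
  have "t i \<le> m i" for i using assms t by (cases "m i = 0") auto
  then show "t \<in> generated {m}" by (simp add: generated_def le_fun_def)
qed

text \<open>This is the ideal generated by the variables \<open>x\<^sub>i\<close> with \<open>m i = 0\<close>. The exponents in \<open>\<langle>m\<rangle>\<close> form a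
face, and a polynomial is outside the ideal iff its support meets that face.\<close>
lemma primeideal_monomial_ideal:
  fixes m :: "'n::finite \<Rightarrow> enat"
  assumes m: "\<forall>i. m i \<in> {0, \<infinity>}"
  shows "primeideal (monomial_ideal (generated {m}) :: ('n, 'k::field) mpoly set) poly_ring"
    (is "primeideal ?P _")
proof (rule primeidealI[OF ideal_monomial_ideal[OF down_closed_generated] cring_poly_ring])
  define Z :: "('n \<Rightarrow>\<^sub>0 nat) set" where "Z = {a. exponent a \<in> generated {m}}"
  have Z: "a \<in> Z \<longleftrightarrow> (\<forall>i. m i = 0 \<longrightarrow> Poly_Mapping.lookup a i = 0)" for a
    unfolding Z_def mem_Collect_eq mem_generated_indicator_iff[OF m] by (simp add: zero_enat_def)
  have face: "a + b \<in> Z \<longleftrightarrow> a \<in> Z \<and> b \<in> Z" for a b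
    unfolding Z by (auto simp: lookup_add)
  have mem: "p \<in> ?P \<longleftrightarrow> Poly_Mapping.keys p \<inter> Z = {}" for p :: "('n, 'k) mpoly"
    unfolding mem_monomial_ideal_iff Z_def by blast
  have "0 \<in> Z" by (simp add: Z)
  then have "1 \<notin> ?P" unfolding mem by (simp flip: single_one)
  then show "carrier poly_ring \<noteq> ?P" by auto
  show "a \<in> ?P \<or> b \<in> ?P" if "a \<otimes>\<^bsub>poly_ring\<^esub> b \<in> ?P" for a b
    using that face_meets_product[OF face, of a b] unfolding mem by auto
qed

text \<open>The inclusion of ideals is tested on the variables \<open>x\<^sub>i\<close> with \<open>m i = 0\<close>: such a variable lies in the
larger ideal only if \<open>m' i = 0\<close> as well.\<close>
lemma generated_subset_if_monomial_ideal_subset: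
  assumes m: "\<forall>i. m i \<in> {0, \<infinity>}" and m': "\<forall>i. m' i \<in> {0, \<infinity>}"
    and sub: "(monomial_ideal (generated {m}) :: ('n, 'k::field) mpoly set) \<subseteq> monomial_ideal (generated {m'})"
  shows "generated {m'} \<subseteq> generated {m}"
proof -
  have "m' i = 0" if "m i = 0" for i
  proof -
    let ?x = "Poly_Mapping.single (Poly_Mapping.single i 1) 1 :: ('n, 'k) mpoly"
    have "?x \<in> monomial_ideal (generated {m})"
      using that by (auto simp: mem_monomial_ideal_iff mem_generated_indicator_iff[OF m] zero_enat_def
          intro!: exI[of _ i])
    then have "?x \<in> monomial_ideal (generated {m'})" using sub by blast
    then obtain j where "m' j = 0" "enat (Poly_Mapping.lookup (Poly_Mapping.single i (1::nat)) j) \<noteq> 0"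
      unfolding mem_monomial_ideal_iff mem_generated_indicator_iff[OF m'] by auto
    then show ?thesis by (cases "j = i") (auto simp: lookup_single_not_eq zero_enat_def)
  qed
  then show ?thesis using mem_generated_indicator_iff[OF m] mem_generated_indicator_iff[OF m'] by blast
qed

text \<open>Let \<open>x\<close> be the monomial whose exponent is the base point of the Stanley set by which \<open>\<Delta>'\<close> exceeds
\<open>\<Delta>\<close>. The monomials in \<open>I(\<Delta>)\<close> but not in \<open>I(\<Delta>')\<close> are the products of \<open>x\<close> with the monomials that have
exponent in \<open>T\<close>. Therefore \<open>I(\<Delta>)/I(\<Delta>')\<close> is generated by \<open>x\<close>, with annihilator \<open>I(T)\<close>.\<close>
lemma stanley_step:
  fixes c :: "'n::finite \<Rightarrow> nat"
  assumes down: "down_closed \<Delta>"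
    and step: "\<Delta>' - \<Delta> = (\<lambda>t i. enat (c i) + t i) ` T" and T: "T = generated {m}"
  defines "x \<equiv> Poly_Mapping.single (Abs_poly_mapping c) 1 :: ('n, 'k::field) mpoly"
  shows "x \<in> monomial_ideal \<Delta> - monomial_ideal \<Delta>'"
    and "\<forall>z\<in>monomial_ideal \<Delta>. \<exists>p. \<exists>n\<in>monomial_ideal \<Delta>'. z = n + p * x"
    and "monomial_ideal T = {p. p * x \<in> monomial_ideal \<Delta>'}"
proof -
  define b where "b = Abs_poly_mapping c"
  have lookup_b: "Poly_Mapping.lookup b = c" unfolding b_def by (rule lookup_Abs_poly_mapping) simp
  have x: "x = Poly_Mapping.single b 1" by (simp add: x_def b_def)
  have sum: "exponent (a + b) = (\<lambda>i. enat (c i) + exponent a i)" for a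
    by (simp add: lookup_add lookup_b fun_eq_iff)
  have "(\<lambda>i. 0) \<in> T" by (simp add: T generated_def le_fun_def)
  then have "(\<lambda>i. enat (c i) + 0) \<in> \<Delta>' - \<Delta>" unfolding step by (rule image_eqI[rotated]) simp
  then have b: "exponent b \<in> \<Delta>' - \<Delta>" by (simp add: lookup_b)
  then show "x \<in> monomial_ideal \<Delta> - monomial_ideal \<Delta>'"
    by (simp add: mem_monomial_ideal_iff x)
  have shift: "exponent (a + b) \<in> \<Delta>' \<longleftrightarrow> exponent a \<in> T" for a
  proof
    assume "exponent (a + b) \<in> \<Delta>'"
    moreover have "exponent b \<le> exponent (a + b)" by (simp add: le_fun_def lookup_add)
    then have "exponent (a + b) \<notin> \<Delta>" using down b unfolding down_closed_def by blast
    ultimately have "exponent (a + b) \<in> (\<lambda>t i. enat (c i) + t i) ` T" using step by blast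
    then obtain t where t: "t \<in> T" "(\<lambda>i. enat (c i) + exponent a i) = (\<lambda>i. enat (c i) + t i)"
      unfolding sum by blast
    have "exponent a i = t i" for i
      using fun_cong[OF t(2), of i] by (metis add_diff_cancel_enat enat.distinct(2))
    then have "exponent a = t" by (rule ext)
    then show "exponent a \<in> T" using t(1) by simp
  next
    assume "exponent a \<in> T"
    then have "exponent (a + b) \<in> (\<lambda>t i. enat (c i) + t i) ` T" unfolding sum by (rule imageI)
    then show "exponent (a + b) \<in> \<Delta>'" unfolding step[symmetric] by (rule DiffD1)
  qed
  show "monomial_ideal T = {p. p * x \<in> monomial_ideal \<Delta>'}"
    unfolding set_eq_iff mem_Collect_eq mem_monomial_ideal_iff x keys_times_monomial
    by (simp only: ball_simps shift) simp
  show "\<forall>z\<in>monomial_ideal \<Delta>. \<exists>p. \<exists>n\<in>monomial_ideal \<Delta>'. z = n + p * x"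
  proof
    fix z :: "('n, 'k) mpoly" assume z: "z \<in> monomial_ideal \<Delta>"
    \<comment> \<open>Split \<open>z\<close> into its terms with exponent in the Stanley set, which are multiples of \<open>x\<close>, and the rest.\<close>
    let ?K = "{a \<in> Poly_Mapping.keys z. exponent a \<in> \<Delta>'}"
    let ?t = "\<lambda>a. Poly_Mapping.single a (Poly_Mapping.lookup z a)"
    define n where "n = (\<Sum>a\<in>Poly_Mapping.keys z - ?K. ?t a)"
    define p where "p = (\<Sum>a\<in>?K. Poly_Mapping.single (a - b) (Poly_Mapping.lookup z a))"
    have "a - b + b = a" if "a \<in> ?K" for a
    proof -
      have "exponent a \<in> (\<lambda>t i. enat (c i) + t i) ` T"
        using that z unfolding mem_monomial_ideal_iff step[symmetric] by blast
      then obtain t where t: "exponent a = (\<lambda>i. enat (c i) + t i)" by blast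
      have "c i \<le> Poly_Mapping.lookup a i" for i
        using fun_cong[OF t, of i] by (metis enat_ord_simps(1) le_iff_add)
      then show ?thesis by (intro poly_mapping_eqI) (simp add: lookup_add lookup_minus lookup_b)
    qed
    then have px: "p * x = (\<Sum>a\<in>?K. ?t a)" by (simp add: p_def x sum_distrib_right mult_single)
    have "z = n + p * x"
      unfolding px by (subst sum_of_terms[of z], unfold n_def, rule sum.subset_diff) auto
    moreover have "n \<in> monomial_ideal \<Delta>'"
      unfolding mem_monomial_ideal_iff n_def
      using keys_sum[of ?t "Poly_Mapping.keys z - ?K"] by (fastforce split: if_splits)
    ultimately show "\<exists>p. \<exists>n\<in>monomial_ideal \<Delta>'. z = n + p * x" by blast
  qed
qed

section \<open>The prime filtration given by a shelling\<close>

lemma generated_facets: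
  assumes "multicomplex \<Gamma>" shows "generated (facets \<Gamma>) = \<Gamma>"
proof
  show "generated (facets \<Gamma>) \<subseteq> \<Gamma>"
    using assms unfolding multicomplex_def generated_def facets_def by blast
  show "\<Gamma> \<subseteq> generated (facets \<Gamma>)"
  proof
    fix a assume "a \<in> \<Gamma>"
    then obtain m where m: "m \<in> maximal_elems \<Gamma>" "a \<le> m"
      using assms unfolding multicomplex_def by blast
    then have "m \<in> facets \<Gamma>" by (auto simp: facets_def maximal_elems_def)
    then show "a \<in> generated (facets \<Gamma>)" using m(2) unfolding generated_def by blast
  qed
qed

text \<open>Adding the facets one at a time, in the order of the shelling, makes the monomial ideal decrease
from the whole ring to \<open>I(\<Gamma>)\<close>; read backwards this is a filtration of \<open>S/I(\<Gamma>)\<close>. Passing from \<open>T\<close> to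
\<open>I(T)\<close> reverses inclusions as well, so the condition on inclusions between the Stanley sets turns
into the condition that makes a prime filtration pretty clean.\<close>
lemma shellable_imp_pretty_clean:
  fixes \<Gamma> :: "('n::finite \<Rightarrow> enat) set"
  assumes "multicomplex \<Gamma>" and "shellable \<Gamma>"
  shows "pretty_clean_ring (poly_ring Quot (monomial_ideal \<Gamma> :: ('n, 'k::field) mpoly set))"
proof -
  obtain r :: nat and a T where a: "bij_betw a {1..r} (facets \<Gamma>)"
    and stanley: "\<forall>i\<in>{1..r}. stanley_set (generated {a i} - generated (a ` {1..<i})) (T i)"
    and order: "\<forall>i\<in>{1..r}. \<forall>j\<in>{1..r}. T i \<subseteq> T j \<longrightarrow> T i = T j \<or> i > j"
    using assms(2) unfolding shellable_def by blast
  define G where "G i = generated (a ` {1..i})" for i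
  have down: "down_closed (G i)" for i unfolding G_def by (rule down_closed_generated)
  have sub: "G (i - 1) \<subseteq> G i" for i unfolding G_def by (intro generated_mono image_mono) auto
  have step: "G i - G (i - 1) = generated {a i} - generated (a ` {1..<i})" if "i \<in> {1..r}" for i
  proof -
    have *: "{1..i} = insert i {1..i - 1}" "{1..<i} = {1..i - 1}" using that by auto
    have "G i = generated {a i} \<union> G (i - 1)" unfolding G_def *(1) by (auto simp: generated_def)
    then show ?thesis unfolding * G_def by blast
  qed
  have "\<forall>i\<in>{1..r}. \<exists>c m. (\<forall>k. m k \<in> {0, \<infinity>}) \<and> T i = generated {m} \<and>
      G i - G (i - 1) = (\<lambda>t k. enat (c k) + t k) ` T i"
    using stanley step unfolding stanley_set_def by metis
  then obtain c :: "nat \<Rightarrow> 'n \<Rightarrow> nat" and m where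
    m: "\<And>i. i \<in> {1..r} \<Longrightarrow> \<forall>k. m i k \<in> {0, \<infinity>}" and T: "\<And>i. i \<in> {1..r} \<Longrightarrow> T i = generated {m i}"
    and c: "\<And>i. i \<in> {1..r} \<Longrightarrow> G i - G (i - 1) = (\<lambda>t k. enat (c i k) + t k) ` T i"
    by metis
  define x :: "nat \<Rightarrow> ('n, 'k) mpoly"
    where "x i = Poly_Mapping.single (Abs_poly_mapping (c i)) 1" for i
  define I :: "nat \<Rightarrow> ('n, 'k) mpoly set" where "I i = monomial_ideal (G i)" for i
  have x: "x i \<in> I (i - 1) - I i"
    and gen: "\<forall>z\<in>I (i - 1). \<exists>p. \<exists>n\<in>I i. z = n + p * x i"
    and ann: "monomial_ideal (T i) = {p. p * x i \<in> I i}" if i: "i \<in> {1..r}" for i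
    unfolding x_def I_def
    using stanley_step[OF down c[OF i] T[OF i]] by blast+
  have "G 0 = {}" by (simp add: G_def generated_def)
  then have I0: "I 0 = UNIV" by (auto simp: I_def mem_monomial_ideal_iff)
  have "a ` {1..r} = facets \<Gamma>" using a by (simp add: bij_betw_def)
  then have Ir: "I r = monomial_ideal \<Gamma>" by (simp only: I_def G_def generated_facets[OF assms(1)])
  have anti: "I i \<subseteq> I (i - 1)" for i
    using sub[of i] unfolding I_def mem_monomial_ideal_iff subset_iff by blast
  \<comment> \<open>The step \<open>k\<close> of the filtration undoes the addition of the facet with number \<open>r - k + 1\<close>.\<close>
  let ?o = "\<lambda>k. Suc (r - k)"
  have o: "?o k \<in> {1..r}" "?o k - 1 = r - k" "r - (k - 1) = ?o k" if "k \<in> {1..r}" for k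
    using that by auto
  show ?thesis
  proof (rule pretty_clean_quotient_ring[where J = "\<lambda>k. I (r - k)" and r = r
        and y = "\<lambda>k. x (?o k)" and Q = "\<lambda>k. monomial_ideal (T (?o k))"])
    show "cring (poly_ring :: ('n, 'k) mpoly ring)" by (rule cring_poly_ring)
    show "I (r - 0) = monomial_ideal \<Gamma>" by (simp add: Ir)
    show "I (r - r) = carrier poly_ring" by (simp add: I0)
    show "\<forall>k\<le>r. ideal (I (r - k)) poly_ring"
      unfolding I_def using ideal_monomial_ideal[OF down] by blast
    show "\<forall>k\<in>{1..r}. I (r - (k - 1)) \<subseteq> I (r - k)" using anti o by metis
    show "\<forall>k\<in>{1..r}. x (?o k) \<in> I (r - k) - I (r - (k - 1))" using x o by metis
    show "\<forall>k\<in>{1..r}. \<forall>z\<in>I (r - k). \<exists>p\<in>carrier poly_ring. \<exists>n\<in>I (r - (k - 1)).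
        z = n \<oplus>\<^bsub>poly_ring\<^esub> p \<otimes>\<^bsub>poly_ring\<^esub> x (?o k)"
    proof
      fix k assume k: "k \<in> {1..r}"
      show "\<forall>z\<in>I (r - k). \<exists>p\<in>carrier poly_ring. \<exists>n\<in>I (r - (k - 1)).
        z = n \<oplus>\<^bsub>poly_ring\<^esub> p \<otimes>\<^bsub>poly_ring\<^esub> x (?o k)"
        using gen[OF o(1)[OF k]] unfolding o[OF k] by simp
    qed
    show "\<forall>k\<in>{1..r}. primeideal (monomial_ideal (T (?o k)) :: ('n, 'k) mpoly set) poly_ring"
      using primeideal_monomial_ideal[OF m] T o(1) by metis
    show "\<forall>k\<in>{1..r}. monomial_ideal (T (?o k)) =
        {p \<in> carrier poly_ring. p \<otimes>\<^bsub>poly_ring\<^esub> x (?o k) \<in> I (r - (k - 1))}"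
      using ann o by simp
    show "\<forall>k\<in>{1..r}. \<forall>l\<in>{1..r}. k < l \<and>
        (monomial_ideal (T (?o k)) :: ('n, 'k) mpoly set) \<subseteq> monomial_ideal (T (?o l)) \<longrightarrow>
        (monomial_ideal (T (?o k)) :: ('n, 'k) mpoly set) = monomial_ideal (T (?o l))"
    proof (intro ballI impI)
      fix k l assume kl: "k \<in> {1..r}" "l \<in> {1..r}" and
        asm: "k < l \<and> (monomial_ideal (T (?o k)) :: ('n, 'k) mpoly set) \<subseteq> monomial_ideal (T (?o l))"
      have "T (?o l) \<subseteq> T (?o k)"
        using generated_subset_if_monomial_ideal_subset[OF m[OF o(1)[OF kl(1)]] m[OF o(1)[OF kl(2)]], where 'k = 'k]
          asm T[OF o(1)[OF kl(1)]] T[OF o(1)[OF kl(2)]] by simp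
      moreover have "?o l < ?o k" using asm kl by auto
      ultimately have "T (?o l) = T (?o k)" using order[rule_format, OF o(1)[OF kl(2)] o(1)[OF kl(1)]] by auto
      then show "(monomial_ideal (T (?o k)) :: ('n, 'k) mpoly set) = monomial_ideal (T (?o l))" by simp
    qed
  qed
qed

theorem theorem3p6:
  fixes \<Gamma> :: "('n::finite \<Rightarrow> enat) set"
  assumes "multicomplex \<Gamma>" and "maximal_shellable \<Gamma>"
  shows "shellable \<Gamma> \<and>
    pretty_clean_ring (poly_ring Quot (monomial_ideal \<Gamma> :: ('n, 'k::field) mpoly set))"
proof -
  have "shellable \<Gamma>" by (rule maximal_shellable_imp_shellable[OF assms])
  then show ?thesis using shellable_imp_pretty_clean[OF assms(1)] by blast
qed

end
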